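(* Let $p$ be an odd prime, let $x\in \mathbb Q_p\setminus\mathbb Z_p$, and let $s\in\mathbb C_p$ with $|s|_p<R_p=p^{(p-2)/(p-1)}$. Then the fermionic $p$-adic integral defining $\zeta_{p,E}(s,x)$ exists, the series below converges, and $$\zeta_{p,E}(s,x)=\int_{\mathbb Z_p}\langle x+a\rangle^{1-s}\,d\mu_{-1}(a)=\langle x\rangle^{1-s}\sum_{i=0}^\infty\binom{1-s}{i}E_i(0)\frac{1}{x^i}.$$ Moreover, the function $s\mapsto\zeta_{p,E}(s,x)$ is $p$-adic analytic on $\{s\in\mathbb C_p: |s|_p<R_p\}$.
   Context: $p$ is an odd prime; $\mathbb Z_p\subset\mathbb Q_p\subset\mathbb C_p$ (the completion of an algebraic closure of $\mathbb Q_p$), $v_p$ the $p$-adic valuation, $|p|_p=p^{-1}$. For $f:\mathbb Z_p\to\mathbb C_p$ uniformly differentiable, the fermionic $p$-adic integral is $\int_{\mathbb Z_p}f(a)\,d\mu_{-1}(a)=\lim_{N\to\infty}\sum_{a=0}^{p^N-1}(-1)^af(a)$. For $y\in\mathbb Z_p^\times$, $\omega(y)$ (Teichmüller character) is the unique $(p-1)$-th root of unity in $\mathbb Z_p$ with $\omega(y)\equiv y\pmod p$, and $\langle y\rangle=y/\omega(y)$. For $y\in\mathbb Q_p^\times$ one sets $\langle y\rangle=\langle y/p^{v_p(y)}\rangle$ and $\omega_v(y)=y/\langle y\rangle=p^{v_p(y)}\omega(y/p^{v_p(y)})$. Since $\langle y\rangle\equiv1\pmod{p}$, the power $\langle y\rangle^{t}=\sum_{k\ge0}\binom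 tk(\langle y\rangle-1)^k$ is defined for $t\in\mathbb C_p$ with $|t|_p<R_p=p^{(p-2)/(p-1)}$. The Euler polynomials $E_m(x)$ are defined by $\frac{2e^{xt}}{e^t+1}=\sum_{m\ge0}E_m(x)\frac{t^m}{m!}$. For $x\in\mathbb Q_p\setminus\mathbb Z_p$ and $|s|_p<R_p$, the $p$-adic Hurwitz-type Euler zeta function is $\zeta_{p,E}(s,x)=\int_{\mathbb Z_p}\langle x+a\rangle^{1-s}\,d\mu_{-1}(a)$. *)

theory Defs
  imports "HOL-Analysis.Analysis" "HOL-Algebra.Algebraic_Closure_Type"
begin

text \<open>
  The field of complex \<open>p\<close>-adic numbers depends on \<open>p\<close>, so it is not one fixed type. It is
  represented by any type \<open>'c\<close> that carries a multiplicative ultrametric absolute value and satisfies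
  \<open>complex_padic_field p TYPE('c)\<close>; such a type is determined by \<open>p\<close> up to isometric isomorphism.
\<close>

class ultrametric_field = field_char_0 + metric_space +
  fixes absv :: "'a \<Rightarrow> real"
  assumes dist_absv: "dist x y = absv (x - y)"
    and absv_mult: "absv (x * y) = absv x * absv y"
    and absv_add: "absv (x + y) \<le> max (absv x) (absv y)"

text \<open>
  When \<open>absv p = 1 / p\<close>, the absolute value of \<open>'c\<close> restricts to the \<open>p\<close>-adic absolute value on the
  rational numbers; in a complete \<open>'c\<close> their topological closure is then the field of
  \<open>p\<close>-adic numbers. The prime thus enters \<open>Q\<^sub>p\<close> and \<open>Z\<^sub>p\<close> through the absolute value of \<open>'c\<close> only.
\<close>

definition padic_rats :: "'c::ultrametric_field set" where
  "padic_rats = closure \<rat>"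

definition padic_ints :: "'c::ultrametric_field set" where
  "padic_ints = {y \<in> padic_rats. absv y \<le> 1}"

definition complex_padic_field :: "nat \<Rightarrow> 'c::ultrametric_field itself \<Rightarrow> bool" where
  "complex_padic_field p _ \<longleftrightarrow>
     absv (of_nat p :: 'c) = 1 / real p \<and>
     complete (UNIV :: 'c set) \<and>
     (\<exists>A :: 'c set. algebraic_closure (ring_of_type_algebra\<lparr>carrier := A\<rparr>) padic_rats \<and>
                    closure A = UNIV)"

definition padic_val :: "nat \<Rightarrow> 'c::ultrametric_field \<Rightarrow> int" where
  "padic_val p y = (THE v. absv y = real p powi (- v))"

text \<open>Only meaningful for \<open>y\<close> in \<open>Z\<^sub>p\<close> with \<open>absv y = 1\<close>.\<close>

definition teichmuller :: "nat \<Rightarrow> 'c::ultrametric_field \<Rightarrow> 'c" where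
  "teichmuller p y =
     (THE w. w \<in> padic_ints \<and> w ^ (p - 1) = 1 \<and> (\<exists>z\<in>padic_ints. w - y = of_nat p * z))"

definition padic_bracket :: "nat \<Rightarrow> 'c::ultrametric_field \<Rightarrow> 'c" where
  "padic_bracket p y = (let u = y / of_nat p powi padic_val p y in u / teichmuller p u)"

definition padic_power :: "'c::ultrametric_field \<Rightarrow> 'c \<Rightarrow> 'c" where
  "padic_power u t = (\<Sum>k. (t gchoose k) * (u - 1) ^ k)"

definition uniformly_differentiable_on ::
    "'c::ultrametric_field set \<Rightarrow> ('c \<Rightarrow> 'c) \<Rightarrow> bool" where
  "uniformly_differentiable_on S f \<longleftrightarrow>
     (\<exists>f'. \<forall>\<epsilon>>0. \<exists>\<delta>>0. \<forall>a\<in>S. \<forall>b\<in>S. a \<noteq> b \<and> dist a b < \<delta> \<longrightarrow>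
        absv ((f b - f a) / (b - a) - f' a) < \<epsilon>)"

definition fermionic_sum :: "nat \<Rightarrow> ('c::ultrametric_field \<Rightarrow> 'c) \<Rightarrow> nat \<Rightarrow> 'c" where
  "fermionic_sum p f N = (\<Sum>a<p ^ N. (- 1) ^ a * f (of_nat a))"

text \<open>
  The integral is only defined for uniformly differentiable functions, so its existence
  comprises that condition as well as the convergence of the defining sequence.
\<close>

definition fermionic_integrable :: "nat \<Rightarrow> ('c::ultrametric_field \<Rightarrow> 'c) \<Rightarrow> bool" where
  "fermionic_integrable p f \<longleftrightarrow>
     uniformly_differentiable_on padic_ints f \<and> convergent (fermionic_sum p f)"

definition fermionic_integral :: "nat \<Rightarrow> ('c::ultrametric_field \<Rightarrow> 'c) \<Rightarrow> 'c" where
  "fermionic_integral p f = lim (fermionic_sum p f)"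

definition euler_poly :: "nat \<Rightarrow> 'c::field_char_0 \<Rightarrow> 'c" where
  "euler_poly m x = fact m * fps_nth (2 * fps_exp x / (fps_exp 1 + 1)) m"

definition padic_euler_zeta :: "nat \<Rightarrow> 'c::ultrametric_field \<Rightarrow> 'c \<Rightarrow> 'c" where
  "padic_euler_zeta p s x =
     fermionic_integral p (\<lambda>a. padic_power (padic_bracket p (x + a)) (1 - s))"

definition padic_radius :: "nat \<Rightarrow> real" where
  "padic_radius p = real p powr ((real p - 2) / (real p - 1))"

text \<open>
  Analytic in the \<open>p\<close>-adic sense: one power series represents the function on the whole disc.
  (Being locally a power series is strictly weaker over a totally disconnected field.)
\<close>

definition padic_analytic_on_disc :: "real \<Rightarrow> ('c::ultrametric_field \<Rightarrow> 'c) \<Rightarrow> bool" where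
  "padic_analytic_on_disc R f \<longleftrightarrow>
     (\<exists>c. \<forall>s. absv s < R \<longrightarrow> (\<lambda>n. c n * s ^ n) sums f s)"

end

(*
  With u = <x>, the factorisation x + a = x (1 + a/x) and |1/x| <= 1/p give
  <x + a> = u (1 + a/x), hence <x + a>^(1-s) = u^(1-s) sum_i binom(1-s,i) (a/x)^i, a power series
  in a whose coefficients tend to 0. Multiplicativity of the powers holds for natural exponents,
  and both sides are power series in s, so the identity theorem extends it to |s| < R_p.
  A power series in a may be integrated term by term, because the alternating sum of a^i over
  a < p^N differs from E_i(0) by at most p^(-N), uniformly in i. Finally, |1/i!| <= p^(i/(p-1))
  and |E_i(0)| <= 1 allow one to rearrange the resulting series into a power series in s.
*)

theory Submission
  imports Defs "HOL-Number_Theory.Residues"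
begin

section \<open>Ultrametric fields\<close>

text \<open>The radius balances two rates: 1/|i!| grows at most like r^i with r = p^(1/(p-1)), while
  |u - 1|^i decays like p^(-i), and the product is R_p^(-i) because R_p = p / r. For odd p this
  radius exceeds 1. Hence s = 1 lies in the disc, which bounds the coefficients of any power series
  there, and so do the points -p^m, which provide the zeros needed for the identity theorem.

  The obstacle is that \<open>'c\<close> has an absolute value but no real scalars. Limits of sums
  and products, convergence of series and exchange of summations are therefore all obtained from the
  strong triangle inequality: null terms suffice for convergence, and a remainder is bounded by its
  largest term. A double series may be exchanged once its terms are small outside finite squares.

  Oddness of p enters twice more: 2 is a unit, so all E_i(0) have absolute value at most 1, and p^N
  is odd, which gives the alternating sum of exponentials the sign that produces E_i(0) +
  E_i(p^N).\<close>

lemma absv_nonneg [simp]: "0 \<le> absv x"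
  using zero_le_dist[of x 0] by (simp add: dist_absv)

lemma absv_eq_0_iff [simp]: "absv x = 0 \<longleftrightarrow> x = 0"
  using dist_eq_0_iff[of x 0] by (simp add: dist_absv)

lemma absv_pos_iff [simp]: "0 < absv x \<longleftrightarrow> x \<noteq> 0"
  using absv_nonneg[of x] absv_eq_0_iff[of x] by linarith

lemma absv_0 [simp]: "absv 0 = 0"
  by simp

lemma absv_1 [simp]: "absv 1 = 1"
  using absv_mult[of 1 1] absv_eq_0_iff[of 1] by simp

lemma absv_minus [simp]: "absv (- x) = absv (x :: 'a::ultrametric_field)"
proof -
  have "absv (- 1 :: 'a) * absv (- 1 :: 'a) = 1"
    using absv_mult[of "- 1 :: 'a" "- 1"] by simp
  then have "absv (- 1 :: 'a) = 1"
    using absv_nonneg[of "- 1 :: 'a"] unfolding square_eq_1_iff by linarith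
  then show ?thesis
    using absv_mult[of "- 1" x] by simp
qed

lemma absv_diff: "absv (x - y) \<le> max (absv x) (absv y)"
  using absv_add[of x "- y"] by simp

lemma absv_minus_commute: "absv (x - y) = absv (y - x)"
  using absv_minus[of "x - y"] by simp

lemma absv_power: "absv (x ^ n) = absv x ^ n"
  by (induction n) (simp_all add: absv_mult)

lemma absv_add_le: "absv x \<le> B \<Longrightarrow> absv y \<le> B \<Longrightarrow> absv (x + y) \<le> B"
  using absv_add[of x y] by linarith

lemma absv_diff_le: "absv x \<le> B \<Longrightarrow> absv y \<le> B \<Longrightarrow> absv (x - y) \<le> B"
  using absv_diff[of x y] by linarith

text \<open>All triangles are isosceles: in x = (x + y) - y the maximum cannot be attained at
  y.\<close>

lemma absv_add_eq:
  assumes "absv y < absv x"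
  shows "absv (x + y) = absv x"
proof (rule antisym)
  show "absv (x + y) \<le> absv x"
    using absv_add[of x y] assms by linarith
  show "absv x \<le> absv (x + y)"
    using absv_diff[of "x + y" y] assms by simp
qed

lemma absv_sum_le:
  assumes "\<And>i. i \<in> A \<Longrightarrow> absv (f i) \<le> B" "0 \<le> B"
  shows "absv (sum f A) \<le> B"
  using assms by (induction A rule: infinite_finite_induct) (auto intro: absv_add_le)

lemma absv_of_nat_le_1: "absv (of_nat n) \<le> 1"
  by (induction n) (auto intro: absv_add_le)

lemma absv_of_int_le_1: "absv (of_int z) \<le> 1"
  by (cases z rule: int_cases2) (auto simp: absv_of_nat_le_1)

lemma absv_inverse: "absv (inverse x) = inverse (absv x)"
proof (cases "x = 0")
  case False
  then have "absv x * absv (inverse x) = 1"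
    using absv_mult[of x "inverse x"] by simp
  then show ?thesis
    by (rule inverse_unique[symmetric])
qed simp

lemma absv_divide: "absv (x / y) = absv x / absv y"
  by (simp add: divide_inverse absv_mult absv_inverse)

lemma absv_power_diff_le:
  fixes x y :: "'a::ultrametric_field"
  assumes "absv x \<le> 1" "absv y \<le> 1"
  shows "absv (x ^ n - y ^ n) \<le> absv (x - y)"
proof (induction n)
  case (Suc n)
  have "x ^ Suc n - y ^ Suc n = x * (x ^ n - y ^ n) + (x - y) * y ^ n"
    by (simp add: algebra_simps)
  moreover have "absv (x * (x ^ n - y ^ n)) \<le> absv (x - y)"
    using mult_mono[OF assms(1) Suc] by (simp add: absv_mult)
  moreover have "absv ((x - y) * y ^ n) \<le> absv (x - y)"
    using mult_mono[OF order_refl power_mono[OF assms(2), of n], of "absv (x - y)"]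
    by (simp add: absv_mult absv_power)
  ultimately show ?case
    by (metis absv_add_le)
qed simp

lemma tendsto_absv_iff:
  fixes l :: "'a::ultrametric_field"
  shows "(f \<longlongrightarrow> l) F \<longleftrightarrow> ((\<lambda>x. absv (f x - l)) \<longlongrightarrow> 0) F"
  by (subst tendsto_dist_iff) (simp add: dist_absv)

lemma tendsto_absvI:
  fixes l :: "'a::ultrametric_field"
  assumes "\<And>x. absv (f x - l) \<le> g x" "(g \<longlongrightarrow> 0) F"
  shows "(f \<longlongrightarrow> l) F"
  unfolding tendsto_absv_iff
  by (rule Lim_null_comparison[OF _ assms(2)]) (use assms(1) in auto)

lemma tendsto_absv:
  fixes l :: "'a::ultrametric_field"
  assumes "(f \<longlongrightarrow> l) F"
  shows "((\<lambda>x. absv (f x)) \<longlongrightarrow> absv l) F"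
  using tendsto_dist[OF assms tendsto_const[of 0]] by (simp add: dist_absv)

text \<open>The class provides only a metric, so joint continuity of the operations has to be
  established before limit rules such as \<open>tendsto_diff\<close> and \<open>tendsto_mult\<close>
  apply to \<open>'c\<close>.\<close>

instance ultrametric_field \<subseteq> topological_ab_group_add
proof
  fix a b :: 'a
  show "((\<lambda>x. fst x + snd x) \<longlongrightarrow> a + b) (nhds a \<times>\<^sub>F nhds b)"
  proof (rule tendsto_absvI)
    fix x :: "'a \<times> 'a"
    have "absv (fst x + snd x - (a + b)) \<le> max (absv (fst x - a)) (absv (snd x - b))"
      using absv_add[of "fst x - a" "snd x - b"] by (simp add: algebra_simps)
    also have "\<dots> \<le> absv (fst x - a) + absv (snd x - b)"
      by simp
    finally show "absv (fst x + snd x - (a + b)) \<le> absv (fst x - a) + absv (snd x - b)" .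
  next
    have "((\<lambda>x. absv (fst x - a)) \<longlongrightarrow> 0) (nhds a \<times>\<^sub>F nhds b)"
      "((\<lambda>x. absv (snd x - b)) \<longlongrightarrow> 0) (nhds a \<times>\<^sub>F nhds b)"
      unfolding tendsto_absv_iff[symmetric] by (rule filterlim_fst filterlim_snd)+
    then show "((\<lambda>x. absv (fst x - a) + absv (snd x - b)) \<longlongrightarrow> 0) (nhds a \<times>\<^sub>F nhds b)"
      using tendsto_add_zero by blast
  qed
  show "(uminus \<longlongrightarrow> - a) (nhds a)"
  proof (rule tendsto_absvI)
    show "absv (- x - - a) \<le> absv (x - a)" for x
      using absv_minus[of "x - a"] by simp
    show "((\<lambda>x. absv (x - a)) \<longlongrightarrow> 0) (nhds a)"
      unfolding tendsto_absv_iff[symmetric] by (rule filterlim_ident)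
  qed
qed

instance ultrametric_field \<subseteq> topological_comm_monoid_mult
proof
  fix a b :: 'a
  show "((\<lambda>x. fst x * snd x) \<longlongrightarrow> a * b) (nhds a \<times>\<^sub>F nhds b)"
  proof (rule tendsto_absvI)
    fix x :: "'a \<times> 'a"
    have "fst x * snd x - a * b = fst x * (snd x - b) + (fst x - a) * b"
      by (simp add: algebra_simps)
    also have "absv \<dots> \<le> max (absv (fst x) * absv (snd x - b)) (absv (fst x - a) * absv b)"
      using absv_add[of "fst x * (snd x - b)" "(fst x - a) * b"] by (simp add: absv_mult)
    also have "\<dots> \<le> absv (fst x) * absv (snd x - b) + absv (fst x - a) * absv b"
      by simp
    finally show "absv (fst x * snd x - a * b)
      \<le> absv (fst x) * absv (snd x - b) + absv (fst x - a) * absv b" .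
  next
    have "((\<lambda>x. absv (fst x - a)) \<longlongrightarrow> 0) (nhds a \<times>\<^sub>F nhds b)"
      "((\<lambda>x. absv (snd x - b)) \<longlongrightarrow> 0) (nhds a \<times>\<^sub>F nhds b)"
      unfolding tendsto_absv_iff[symmetric] by (rule filterlim_fst filterlim_snd)+
    \<comment> \<open>The factor \<open>absv (fst x)\<close> has no global bound; its convergence to
      \<open>absv a\<close> is enough for the product with a null function to vanish.\<close>
    moreover have "((\<lambda>x. absv (fst x)) \<longlongrightarrow> absv a) (nhds a \<times>\<^sub>F nhds b)"
      by (rule tendsto_absv) (rule filterlim_fst)
    ultimately show "((\<lambda>x. absv (fst x) * absv (snd x - b) + absv (fst x - a) * absv b)
        \<longlongrightarrow> 0) (nhds a \<times>\<^sub>F nhds b)"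
      by (auto intro!: tendsto_eq_intros)
  qed
qed

section \<open>Convergent series and exchange of summations\<close>

lemma absv_LIMSEQ_le:
  fixes l :: "'a::ultrametric_field"
  assumes "f \<longlonglongrightarrow> l" "\<And>n. n \<ge> N \<Longrightarrow> absv (f n) \<le> B"
  shows "absv l \<le> B"
  using LIMSEQ_le_const2[OF tendsto_absv[OF assms(1)]] assms(2) by blast

lemma sums_cmult:
  fixes f :: "nat \<Rightarrow> 'a::ultrametric_field"
  assumes "f sums a"
  shows "(\<lambda>n. c * f n) sums (c * a)"
  using tendsto_mult[OF tendsto_const assms[unfolded sums_def], of c]
  by (simp add: sums_def sum_distrib_left)

lemma absv_sums_le:
  fixes f :: "nat \<Rightarrow> 'a::ultrametric_field"
  assumes "f sums a" "\<And>n. absv (f n) \<le> B"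
  shows "absv a \<le> B"
proof (rule absv_LIMSEQ_le[OF assms(1)[unfolded sums_def]])
  show "absv (sum f {..<n}) \<le> B" for n
    using assms(2) order_trans[OF absv_nonneg assms(2)] by (intro absv_sum_le)
qed

lemma ultrametric_sums_diff:
  fixes f g :: "nat \<Rightarrow> 'a::ultrametric_field"
  assumes "f sums a" "g sums b"
  shows "(\<lambda>n. f n - g n) sums (a - b)"
  using assms unfolding sums_def by (auto simp: sum_subtractf intro: tendsto_diff)

lemma ultrametric_sums_shift_iff:
  fixes f :: "nat \<Rightarrow> 'a::ultrametric_field"
  shows "(\<lambda>n. f (n + N)) sums a \<longleftrightarrow> f sums (a + sum f {..<N})"
proof -
  have "(\<Sum>i<n. f (i + N)) = sum f {..<n + N} - sum f {..<N}" for n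
    by (induction n) (simp_all add: algebra_simps)
  then have "(\<lambda>n. f (n + N)) sums a \<longleftrightarrow> (\<lambda>n. sum f {..<n + N} - sum f {..<N}) \<longlonglongrightarrow> a"
    by (simp add: sums_def)
  also have "\<dots> \<longleftrightarrow> (\<lambda>n. sum f {..<n + N}) \<longlonglongrightarrow> a + sum f {..<N}"
    by (simp add: tendsto_absv_iff algebra_simps)
  finally show ?thesis
    unfolding sums_def
    by (auto dest: LIMSEQ_offset intro: LIMSEQ_ignore_initial_segment[of "\<lambda>n. sum f {..<n}"])
qed

lemma absv_sums_diff_le:
  fixes f :: "nat \<Rightarrow> 'a::ultrametric_field"
  assumes "f sums a" "\<And>n. n \<ge> N \<Longrightarrow> absv (f n) \<le> B"
  shows "absv (a - sum f {..<N}) \<le> B"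
proof (rule absv_sums_le)
  show "(\<lambda>n. f (n + N)) sums (a - sum f {..<N})"
    using assms(1) by (simp add: ultrametric_sums_shift_iff)
qed (simp add: assms(2))

lemma absv_sums_imp_null:
  fixes f :: "nat \<Rightarrow> 'a::ultrametric_field"
  assumes "f sums a"
  shows "(\<lambda>n. absv (f n)) \<longlonglongrightarrow> 0"
proof -
  have "(\<lambda>n. sum f {..<Suc n} - sum f {..<n}) \<longlonglongrightarrow> a - a"
    using assms unfolding sums_def by (intro tendsto_diff LIMSEQ_Suc)
  then show ?thesis
    using tendsto_absv by fastforce
qed

lemma ultrametric_summable:
  fixes f :: "nat \<Rightarrow> 'a::ultrametric_field"
  assumes "complete (UNIV :: 'a set)" "(\<lambda>n. absv (f n)) \<longlonglongrightarrow> 0"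
  shows "summable f"
proof -
  have "Cauchy (\<lambda>n. sum f {..<n})"
  proof (rule metric_CauchyI)
    fix e :: real
    assume "e > 0"
    then obtain N where N: "\<And>n. n \<ge> N \<Longrightarrow> absv (f n) < e / 2"
      using LIMSEQ_D[OF assms(2), of "e / 2"] by auto
    \<comment> \<open>Both late partial sums are compared with the one at \<open>N\<close>, so the
      order of \<open>m\<close> and \<open>n\<close> is irrelevant. The bound \<open>e / 2\<close>
      compensates for the weak inequality.\<close>
    have near: "absv (sum f {..<m} - sum f {..<N}) \<le> e / 2" if "m \<ge> N" for m
    proof -
      have "sum f {..<m} - sum f {..<N} = sum f {N..<m}"
        using sum_diff_nat_ivl[of 0 N m f] that by (simp add: atLeast0LessThan)
      moreover have "absv (sum f {N..<m}) \<le> e / 2"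
        using \<open>e > 0\<close> by (intro absv_sum_le less_imp_le[OF N]) auto
      ultimately show ?thesis
        by simp
    qed
    have "absv (sum f {..<m} - sum f {..<N} - (sum f {..<n} - sum f {..<N})) \<le> e / 2"
      if "m \<ge> N" "n \<ge> N" for m n
      using that by (rule absv_diff_le[OF near near])
    then show "\<exists>M. \<forall>m\<ge>M. \<forall>n\<ge>M. dist (sum f {..<m}) (sum f {..<n}) < e"
      using \<open>e > 0\<close> by (force simp: dist_absv)
  qed
  then show ?thesis
    using assms(1) by (auto simp: complete_def summable_def sums_def)
qed

text \<open>The hypothesis says that outside a finite square all entries are small; it takes the
  place of absolute summability. Either iterated sum differs from the square partial sums by a null
  sequence, and these sums are symmetric in the two indices.\<close>

lemma ultrametric_sums_swap:
  fixes T :: "nat \<Rightarrow> nat \<Rightarrow> 'a::ultrametric_field"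
  assumes complete: "complete (UNIV :: 'a set)"
    and small: "\<And>e. e > 0 \<Longrightarrow> \<exists>N. \<forall>i n. N \<le> i \<or> N \<le> n \<longrightarrow> absv (T i n) < e"
  obtains S where
    "\<And>i. T i sums (\<Sum>n. T i n)" "\<And>n. (\<lambda>i. T i n) sums (\<Sum>i. T i n)"
    "(\<lambda>i. \<Sum>n. T i n) sums S" "(\<lambda>n. \<Sum>i. T i n) sums S"
proof -
  \<comment> \<open>Stated for an arbitrary array so that it can be applied both to \<open>T\<close>
    and to its transpose.\<close>
  have main: "(\<forall>i. U i sums (\<Sum>n. U i n)) \<and> summable (\<lambda>i. \<Sum>n. U i n) \<and>
      (\<lambda>N. (\<Sum>i<N. \<Sum>n. U i n) - (\<Sum>i<N. \<Sum>n<N. U i n)) \<longlonglongrightarrow> 0"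
    if small: "\<And>e. e > 0 \<Longrightarrow> \<exists>N. \<forall>i n. N \<le> i \<or> N \<le> n \<longrightarrow> absv (U i n) < e"
    for U :: "nat \<Rightarrow> nat \<Rightarrow> 'a"
  proof -
    have row: "U i sums (\<Sum>n. U i n)" for i
    proof (intro summable_sums ultrametric_summable[OF complete] LIMSEQ_I)
      fix r :: real
      assume "r > 0"
      then show "\<exists>N. \<forall>n\<ge>N. norm (absv (U i n) - 0) < r"
        using small[of r] by fastforce
    qed
    have rows: "summable (\<lambda>i. \<Sum>n. U i n)"
    proof (intro ultrametric_summable[OF complete] LIMSEQ_I)
      fix r :: real
      assume "r > 0"
      then obtain N where N: "\<And>i n. N \<le> i \<Longrightarrow> absv (U i n) < r / 2"
        using small[of "r / 2"] by auto
      have "absv (\<Sum>n. U i n) \<le> r / 2" if "i \<ge> N" for i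
        using absv_sums_le[OF row less_imp_le[OF N[OF that]]] .
      then show "\<exists>N. \<forall>i\<ge>N. norm (absv (\<Sum>n. U i n) - 0) < r"
        using \<open>r > 0\<close> by fastforce
    qed
    have "(\<lambda>N. (\<Sum>i<N. \<Sum>n. U i n) - (\<Sum>i<N. \<Sum>n<N. U i n)) \<longlonglongrightarrow> 0"
      unfolding tendsto_absv_iff
    proof (intro LIMSEQ_I)
      fix r :: real
      assume "r > 0"
      then obtain N where N: "\<And>i n. N \<le> n \<Longrightarrow> absv (U i n) < r / 2"
        using small[of "r / 2"] by auto
      have "absv ((\<Sum>i<M. \<Sum>n. U i n) - (\<Sum>i<M. \<Sum>n<M. U i n)) \<le> r / 2" if "M \<ge> N" for M
        unfolding sum_subtractf[symmetric] using that \<open>r > 0\<close>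
        by (intro absv_sum_le absv_sums_diff_le row less_imp_le[OF N]) auto
      then show "\<exists>N. \<forall>M\<ge>N. norm (absv ((\<Sum>i<M. \<Sum>n. U i n) -
          (\<Sum>i<M. \<Sum>n<M. U i n) - 0) - 0) < r"
        using \<open>r > 0\<close> by (intro exI[of _ N]) fastforce
    qed
    with row rows show ?thesis
      by blast
  qed
  note rows = main[OF small]
  have "\<exists>N. \<forall>i n. N \<le> i \<or> N \<le> n \<longrightarrow> absv (T n i) < e" if "e > 0" for e
    using small[OF that] by blast
  note cols = main[of "\<lambda>i n. T n i", OF this]
  define S where "S = (\<Sum>i. \<Sum>n. T i n)"
  have S: "(\<lambda>i. \<Sum>n. T i n) sums S"
    using rows by (auto simp: S_def)
  have "(\<lambda>N. (\<Sum>n<N. \<Sum>i. T i n) - (\<Sum>n<N. \<Sum>i<N. T i n)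
      + (\<Sum>i<N. \<Sum>n. T i n) - ((\<Sum>i<N. \<Sum>n. T i n) - (\<Sum>i<N. \<Sum>n<N. T i n))) \<longlonglongrightarrow> 0 + S - 0"
    using rows cols S unfolding sums_def by (intro tendsto_diff tendsto_add) auto
  moreover have "(\<Sum>n<N. \<Sum>i<N. T i n) = (\<Sum>i<N. \<Sum>n<N. T i n)" for N
    by (rule sum.swap)
  ultimately have "(\<lambda>n. \<Sum>i. T i n) sums S"
    by (simp add: sums_def)
  with S show ?thesis
    using that rows cols by blast
qed

lemma ultrametric_Cauchy_product:
  fixes f g :: "nat \<Rightarrow> 'a::ultrametric_field"
  assumes complete: "complete (UNIV :: 'a set)" and f: "f sums a" and g: "g sums b"
  shows "(\<lambda>n. \<Sum>i\<le>n. f i * g (n - i)) sums (a * b)"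
proof -
  \<comment> \<open>Row \<open>i\<close> is the series \<open>g\<close> shifted by \<open>i\<close>
    and scaled by \<open>f i\<close>, so it sums to \<open>f i * b\<close>; column \<open>n\<close>
    is the n-th term of the Cauchy product.\<close>
  define T where "T i n = (if i \<le> n then f i * g (n - i) else 0)" for i n
  have null: "(\<lambda>n. absv (f n)) \<longlonglongrightarrow> 0" "(\<lambda>n. absv (g n)) \<longlonglongrightarrow> 0"
    using absv_sums_imp_null f g by auto
  then have "Bseq (\<lambda>n. absv (f n))" "Bseq (\<lambda>n. absv (g n))"
    by (auto intro!: convergent_imp_Bseq convergentI)
  then obtain F G where FG: "F > 0" "\<And>n. absv (f n) \<le> F" "G > 0" "\<And>n. absv (g n) \<le> G"
    by (auto simp: Bseq_def)
  have "\<exists>N. \<forall>i n. N \<le> i \<or> N \<le> n \<longrightarrow> absv (T i n) < e" if "e > 0" for e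
  proof -
    obtain K where K: "\<And>n. n \<ge> K \<Longrightarrow> absv (f n) < e / G"
      using LIMSEQ_D[OF null(1) divide_pos_pos[OF \<open>e > 0\<close> FG(3)]] by auto
    obtain L where L: "\<And>n. n \<ge> L \<Longrightarrow> absv (g n) < e / F"
      using LIMSEQ_D[OF null(2) divide_pos_pos[OF \<open>e > 0\<close> FG(1)]] by auto
    \<comment> \<open>A nonzero entry has \<open>i \<le> n\<close>, so either alternative gives
      \<open>n \<ge> K + L\<close>, and then one of the two factors is far out in its
      sequence.\<close>
    have "absv (T i n) < e" if large: "K + L \<le> i \<or> K + L \<le> n" for i n
    proof (cases "i \<le> n")
      case True
      then consider "i \<ge> K" | "n - i \<ge> L"
        using large by linarith
      then show ?thesis
      proof cases
        case 1
        have "absv (f i) * absv (g (n - i)) \<le> absv (f i) * G"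
          using FG by (intro mult_left_mono) auto
        also have "\<dots> < e"
          using K[OF 1] FG by (simp add: field_simps)
        finally show ?thesis
          using True by (simp add: T_def absv_mult)
      next
        case 2
        have "absv (f i) * absv (g (n - i)) \<le> F * absv (g (n - i))"
          using FG by (intro mult_right_mono) auto
        also have "\<dots> < e"
          using L[OF 2] FG by (simp add: field_simps)
        finally show ?thesis
          using True by (simp add: T_def absv_mult)
      qed
    qed (use \<open>e > 0\<close> in \<open>simp add: T_def\<close>)
    then show ?thesis
      by blast
  qed
  then obtain S where S: "(\<lambda>i. \<Sum>n. T i n) sums S" "(\<lambda>n. \<Sum>i. T i n) sums S"
    using ultrametric_sums_swap[OF complete] by metis
  have "T i sums (f i * b)" for i
  proof -
    have "(\<lambda>n. T i (n + i)) sums (f i * b)"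
      using sums_cmult[OF g, of "f i"] by (simp add: T_def)
    then show ?thesis
      by (simp add: ultrametric_sums_shift_iff) (simp add: T_def)
  qed
  then have "(\<Sum>n. T i n) = f i * b" for i
    by (metis sums_unique)
  with S(1) have "(\<lambda>i. f i * b) sums S"
    by simp
  moreover have "(\<lambda>i. f i * b) sums (a * b)"
    using sums_cmult[OF f, of b] by (simp add: mult.commute)
  ultimately have "S = a * b"
    using sums_unique2 by blast
  moreover have "(\<Sum>i. T i n) = (\<Sum>i\<le>n. f i * g (n - i))" for n
    by (subst suminf_finite[of "{..n}"]) (auto simp: T_def)
  ultimately show ?thesis
    using S(2) by simp
qed

section \<open>Power series on discs\<close>

lemma padic_analytic_on_disc_diff:
  assumes "padic_analytic_on_disc R f" "padic_analytic_on_disc R g"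
  shows "padic_analytic_on_disc R (\<lambda>s. f s - g s)"
proof -
  obtain a b where "\<And>s. absv s < R \<Longrightarrow> (\<lambda>n. a n * s ^ n) sums f s"
    "\<And>s. absv s < R \<Longrightarrow> (\<lambda>n. b n * s ^ n) sums g s"
    using assms unfolding padic_analytic_on_disc_def by blast
  then have "\<And>s. absv s < R \<Longrightarrow> (\<lambda>n. (a n - b n) * s ^ n) sums (f s - g s)"
    using ultrametric_sums_diff by (fastforce simp: left_diff_distrib)
  then show ?thesis
    unfolding padic_analytic_on_disc_def by (intro exI[of _ "\<lambda>n. a n - b n"]) blast
qed

lemma padic_analytic_on_disc_mult:
  fixes f g :: "'c::ultrametric_field \<Rightarrow> 'c"
  assumes complete: "complete (UNIV :: 'c set)"
    and "padic_analytic_on_disc R f" "padic_analytic_on_disc R g"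
  shows "padic_analytic_on_disc R (\<lambda>s. f s * g s)"
proof -
  obtain a b where ab: "\<And>s. absv s < R \<Longrightarrow> (\<lambda>n. a n * s ^ n) sums f s"
    "\<And>s. absv s < R \<Longrightarrow> (\<lambda>n. b n * s ^ n) sums g s"
    using assms unfolding padic_analytic_on_disc_def by blast
  have "(\<lambda>n. (\<Sum>i\<le>n. a i * b (n - i)) * s ^ n) sums (f s * g s)" if "absv s < R" for s
  proof -
    have "(\<Sum>i\<le>n. a i * s ^ i * (b (n - i) * s ^ (n - i))) = (\<Sum>i\<le>n. a i * b (n - i)) * s ^ n" for n
      unfolding sum_distrib_right
      by (rule sum.cong) (auto simp: mult_ac simp flip: power_add)
    then show ?thesis
      using ultrametric_Cauchy_product[OF complete ab[OF that]] by simp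
  qed
  then show ?thesis
    unfolding padic_analytic_on_disc_def by (intro exI[of _ "\<lambda>n. \<Sum>i\<le>n. a i * b (n - i)"]) simp
qed

lemma padic_analytic_on_disc_cong:
  assumes "padic_analytic_on_disc R f" "\<And>s. absv s < R \<Longrightarrow> f s = g s"
  shows "padic_analytic_on_disc R g"
  using assms unfolding padic_analytic_on_disc_def by metis

text \<open>If all coefficients below n vanish, then at a zero z with |z| \<le> 1 the term c_n z^n
  is cancelled by a tail of size at most M |z|^(n+1). Dividing by |z|^n and letting z tend to 0
  yields c_n = 0.\<close>

lemma padic_analytic_identity:
  fixes f :: "'c::ultrametric_field \<Rightarrow> 'c"
  assumes "padic_analytic_on_disc R f" "1 < R"
    and z: "z \<longlonglongrightarrow> 0" "\<And>m. z m \<noteq> 0" "\<And>m. absv (z m) \<le> 1" "\<And>m. f (z m) = 0"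
    and "absv s < R"
  shows "f s = 0"
proof -
  obtain c where c: "\<And>s. absv s < R \<Longrightarrow> (\<lambda>n. c n * s ^ n) sums f s"
    using assms(1) unfolding padic_analytic_on_disc_def by blast
  have "c n = 0" for n
  proof (induction n rule: less_induct)
    case (less n)
    \<comment> \<open>Convergence at \<open>s = 1\<close>, which lies in the disc, makes the
      coefficients themselves a null sequence.\<close>
    have "(\<lambda>n. absv (c n)) \<longlonglongrightarrow> 0"
      using absv_sums_imp_null[OF c[of 1]] \<open>1 < R\<close> by simp
    then have "Bseq (\<lambda>n. absv (c n))"
      by (intro convergent_imp_Bseq convergentI)
    then obtain M where M: "\<And>n. absv (c n) \<le> M"
      by (auto simp: Bseq_def)
    have "absv (c n) \<le> M * absv (z m)" for m
    proof -
      have "(\<lambda>i. c i * z m ^ i) sums 0"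
        using c[of "z m"] z(3)[of m] \<open>1 < R\<close> by (simp add: z(4))
      then have "absv (0 - (\<Sum>i<Suc n. c i * z m ^ i)) \<le> M * absv (z m) ^ Suc n"
      proof (rule absv_sums_diff_le)
        fix k
        assume "Suc n \<le> k"
        then have "absv (z m) ^ k \<le> absv (z m) ^ Suc n"
          by (intro power_decreasing z) auto
        then show "absv (c k * z m ^ k) \<le> M * absv (z m) ^ Suc n"
          using mult_mono[OF M] order_trans[OF absv_nonneg M] by (simp add: absv_mult absv_power)
      qed
      moreover have "(\<Sum>i<Suc n. c i * z m ^ i) = c n * z m ^ n"
        using less by simp
      ultimately have "absv (c n) * absv (z m) ^ n \<le> M * absv (z m) * absv (z m) ^ n"
        by (simp add: absv_mult absv_power mult_ac)
      then show ?thesis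
        using z(2) by (simp add: mult_le_cancel_right)
    qed
    moreover have "(\<lambda>m. M * absv (z m)) \<longlonglongrightarrow> M * absv (0 :: 'c)"
      by (intro tendsto_mult tendsto_const tendsto_absv z)
    ultimately have "absv (c n) \<le> M * absv (0 :: 'c)"
      by (intro LIMSEQ_le_const) auto
    then show "c n = 0"
      using absv_nonneg[of "c n"] by simp
  qed
  then show ?thesis
    using c[OF \<open>absv s < R\<close>] sums_unique2[OF sums_zero] by simp
qed

text \<open>Expanding each polynomial gives the array of terms \<open>coeff (Q i) n * s ^ n\<close>.
  Its rows sum to the polynomials and its columns to the terms of a power series in
  \<open>s\<close>, so exchanging the summations proves analyticity.\<close>

lemma padic_analytic_poly_series:
  fixes Q :: "nat \<Rightarrow> 'c::ultrametric_field poly"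
  assumes complete: "complete (UNIV :: 'c set)" and R: "1 < R"
    and deg: "\<And>i. Polynomial.degree (Q i) \<le> i" and bound: "\<And>i n. absv (Polynomial.coeff (Q i) n) \<le> C / R ^ i"
  shows "absv s < R \<Longrightarrow> summable (\<lambda>i. poly (Q i) s)"
    and "padic_analytic_on_disc R (\<lambda>s. \<Sum>i. poly (Q i) s)"
proof -
  have C: "C \<ge> 0"
    using order_trans[OF absv_nonneg bound[of 0 0]] by simp
  define c where "c n = (\<Sum>i. Polynomial.coeff (Q i) n)" for n
  have c: "(\<lambda>i. Polynomial.coeff (Q i) n) sums c n" for n
    unfolding c_def
  proof (intro summable_sums ultrametric_summable[OF complete])
    show "(\<lambda>i. absv (Polynomial.coeff (Q i) n)) \<longlonglongrightarrow> 0"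
    proof (rule Lim_null_comparison)
      have "(\<lambda>i. C * (1 / R) ^ i) \<longlonglongrightarrow> C * 0"
        using R by (intro tendsto_mult tendsto_const LIMSEQ_realpow_zero) auto
      then show "(\<lambda>i. C / R ^ i) \<longlonglongrightarrow> 0"
        by (simp add: power_one_over)
    qed (use bound in auto)
  qed
  have main: "summable (\<lambda>i. poly (Q i) s) \<and> (\<lambda>n. c n * s ^ n) sums (\<Sum>i. poly (Q i) s)"
    if s: "absv s < R" for s
  proof -
    \<comment> \<open>The maximum with 1 allows |s|^n to be replaced by a power with the larger
      exponent i; the quotient stays below 1 because \<open>1 < R\<close>.\<close>
    define q where "q = max 1 (absv s) / R"
    have q: "0 \<le> q" "q < 1"
      using R s by (auto simp: q_def)
    have T: "absv (Polynomial.coeff (Q i) n * s ^ n) \<le> C * q ^ i" for i n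
    proof (cases "n \<le> i")
      case True
      have "absv s ^ n \<le> max 1 (absv s) ^ n"
        by (intro power_mono) auto
      also have "\<dots> \<le> max 1 (absv s) ^ i"
        using True by (intro power_increasing) auto
      finally have "absv (Polynomial.coeff (Q i) n * s ^ n) \<le> C / R ^ i * max 1 (absv s) ^ i"
        unfolding absv_mult absv_power using C R by (intro mult_mono bound) auto
      then show ?thesis
        by (simp add: q_def power_divide)
    next
      case False
      then have "Polynomial.coeff (Q i) n = 0"
        using deg[of i] by (intro coeff_eq_0) auto
      then show ?thesis
        using C q by simp
    qed
    have "\<exists>N. \<forall>i n. N \<le> i \<or> N \<le> n \<longrightarrow> absv (Polynomial.coeff (Q i) n * s ^ n) < e" if "e > 0" for e
    proof -
      have "(\<lambda>i. C * q ^ i) \<longlonglongrightarrow> C * 0"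
        using q by (intro tendsto_mult tendsto_const LIMSEQ_realpow_zero) auto
      then have "\<forall>\<^sub>F i in sequentially. C * q ^ i < e"
        using \<open>e > 0\<close> by (intro order_tendstoD(2)) auto
      then obtain N where N: "\<And>i. i \<ge> N \<Longrightarrow> C * q ^ i < e"
        by (auto simp: eventually_sequentially)
      have "absv (Polynomial.coeff (Q i) n * s ^ n) < e" if "N \<le> i \<or> N \<le> n" for i n
      proof (cases "i \<ge> N")
        case True
        then show ?thesis
          using T[of i n] N[of i] by linarith
      next
        \<comment> \<open>Here \<open>i < N\<close>, hence \<open>N \<le> n\<close>, and the entry
          lies above the degree of \<open>Q i\<close>.\<close>
        case False
        then have "Polynomial.coeff (Q i) n = 0"
          using deg[of i] that by (intro coeff_eq_0) auto
        then show ?thesis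
          using \<open>e > 0\<close> by simp
      qed
      then show ?thesis
        by blast
    qed
    note swap = ultrametric_sums_swap[OF complete, of "\<lambda>i n. Polynomial.coeff (Q i) n * s ^ n", OF this]
    obtain S where S: "(\<lambda>i. \<Sum>n. Polynomial.coeff (Q i) n * s ^ n) sums S"
        "(\<lambda>n. \<Sum>i. Polynomial.coeff (Q i) n * s ^ n) sums S"
      by (rule swap)
    have "(\<Sum>n. Polynomial.coeff (Q i) n * s ^ n) = poly (Q i) s" for i
      unfolding poly_altdef by (rule suminf_finite) (auto simp: coeff_eq_0)
    moreover have "(\<Sum>i. Polynomial.coeff (Q i) n * s ^ n) = c n * s ^ n" for n
      using sums_unique[OF sums_cmult[OF c, of "s ^ n"]] by (simp add: mult.commute)
    ultimately show ?thesis
      using S by (auto simp: sums_iff)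
  qed
  show "absv s < R \<Longrightarrow> summable (\<lambda>i. poly (Q i) s)"
    using main by blast
  show "padic_analytic_on_disc R (\<lambda>s. \<Sum>i. poly (Q i) s)"
    unfolding padic_analytic_on_disc_def using main by blast
qed

section \<open>Binomial coefficients as polynomials in s\<close>

definition gchoose_poly :: "nat \<Rightarrow> 'c::ultrametric_field poly" where
  "gchoose_poly i = Polynomial.smult (1 / fact i) (\<Prod>j<i. [:1 - of_nat j, - 1:])"

lemma poly_gchoose_poly: "poly (gchoose_poly i) s = (1 - s) gchoose i"
  by (simp add: gchoose_poly_def gbinomial_prod_rev poly_prod atLeast0LessThan algebra_simps)

lemma degree_gchoose_poly: "Polynomial.degree (gchoose_poly i) \<le> i"
proof -
  have "Polynomial.degree (\<Prod>j<i. [:1 - of_nat j, - 1:] :: 'a poly) \<le> (\<Sum>j<i. 1)"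
    by (rule order_trans[OF degree_prod_sum_le]) (auto intro!: sum_mono)
  then show ?thesis
    by (simp add: gchoose_poly_def)
qed

text \<open>The product of the linear factors has integer coefficients, so only the factor 1/i! can
  make a coefficient large.\<close>

lemma absv_coeff_gchoose_poly:
  "absv (Polynomial.coeff (gchoose_poly i :: 'c::ultrametric_field poly) n) \<le> 1 / absv (fact i :: 'c)"
proof -
  have "absv (Polynomial.coeff (\<Prod>j<i. [:1 - of_nat j, - 1:] :: 'c poly) n) \<le> 1"
  proof (induction i arbitrary: n)
    case (Suc i)
    let ?P = "\<Prod>j<i. [:1 - of_nat j, - 1:] :: 'c poly"
    have "Polynomial.coeff (\<Prod>j<Suc i. [:1 - of_nat j, - 1:] :: 'c poly) n
      = (1 - of_nat i) * Polynomial.coeff ?P n - (if n = 0 then 0 else Polynomial.coeff ?P (n - 1))"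
      by (cases n) (simp_all add: mult.commute[of _ "[:_, _:]"] coeff_pCons)
    moreover have "absv (1 - of_nat i :: 'c) \<le> 1"
      by (intro absv_diff_le) (simp_all add: absv_of_nat_le_1)
    then have "absv ((1 - of_nat i) * Polynomial.coeff ?P n) \<le> 1"
      unfolding absv_mult by (intro mult_le_one Suc) auto
    ultimately show ?case
      using Suc by (auto intro!: absv_diff_le)
  qed (simp add: coeff_1)
  then show ?thesis
    by (auto simp: gchoose_poly_def absv_mult absv_divide intro!: divide_right_mono)
qed

section \<open>The angle bracket\<close>

lemma padic_rats_ops:
  fixes x y :: "'c::ultrametric_field"
  assumes "x \<in> padic_rats" "y \<in> padic_rats"
  shows "x + y \<in> padic_rats" "x - y \<in> padic_rats" "x * y \<in> padic_rats"
proof -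
  obtain f g where fg: "\<And>n. f n \<in> \<rat>" "f \<longlonglongrightarrow> x" "\<And>n. g n \<in> \<rat>" "g \<longlonglongrightarrow> y"
    using assms unfolding padic_rats_def closure_sequential by auto
  show "x + y \<in> padic_rats"
    unfolding padic_rats_def closure_sequential
    by (intro exI[of _ "\<lambda>n. f n + g n"]) (auto intro!: tendsto_add Rats_add fg)
  show "x - y \<in> padic_rats"
    unfolding padic_rats_def closure_sequential
    by (intro exI[of _ "\<lambda>n. f n - g n"]) (auto intro!: tendsto_diff Rats_diff fg)
  show "x * y \<in> padic_rats"
    unfolding padic_rats_def closure_sequential
    by (intro exI[of _ "\<lambda>n. f n * g n"]) (auto intro!: tendsto_mult Rats_mult fg)
qed

lemma Rats_subset_padic_rats: "\<rat> \<subseteq> padic_rats"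
  unfolding padic_rats_def by (rule closure_subset)

lemma of_nat_in_padic_ints: "of_nat n \<in> padic_ints"
  using Rats_subset_padic_rats by (auto simp: padic_ints_def absv_of_nat_le_1)

lemma padic_ints_power: "x \<in> padic_ints \<Longrightarrow> x ^ n \<in> padic_ints"
proof (induction n)
  case (Suc n)
  then show ?case
    by (auto simp: padic_ints_def absv_mult intro!: padic_rats_ops mult_le_one)
qed (use of_nat_in_padic_ints[of 1] in simp)

lemma padic_ints_LIMSEQ:
  assumes "\<And>n. f n \<in> padic_ints" "f \<longlonglongrightarrow> l"
  shows "l \<in> padic_ints"
proof -
  have "l \<in> padic_rats"
    using assms closed_sequentially[of padic_rats f l]
    by (auto simp: padic_rats_def padic_ints_def)
  moreover have "absv l \<le> 1"
    using absv_LIMSEQ_le[OF assms(2), of 0 1] assms(1) by (simp add: padic_ints_def)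
  ultimately show ?thesis
    by (simp add: padic_ints_def)
qed

text \<open>The sum is the difference quotient (a^n - b^n)/(a - b), here compared with the
  derivative n b^(n-1). This one estimate yields the contraction of the p-th power map, the
  separation of roots of unity and the differentiability of power series.\<close>

lemma absv_geometric_diff_le:
  fixes a b :: "'c::ultrametric_field"
  assumes "absv a \<le> 1" "absv b \<le> 1"
  shows "absv ((\<Sum>i<n. b ^ (n - Suc i) * a ^ i) - of_nat n * b ^ (n - 1)) \<le> absv (a - b)"
proof -
  have "(\<Sum>i<n. b ^ (n - Suc i) * a ^ i) - of_nat n * b ^ (n - 1)
    = (\<Sum>i<n. b ^ (n - Suc i) * (a ^ i - b ^ i))"
    by (auto simp: right_diff_distrib sum_subtractf simp flip: power_add)
  moreover have "absv (b ^ (n - Suc i) * (a ^ i - b ^ i)) \<le> absv (a - b)" for i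
  proof -
    have "absv (b ^ (n - Suc i)) \<le> 1"
      using assms by (simp add: absv_power power_le_one)
    then show ?thesis
      using mult_mono[OF _ absv_power_diff_le[OF assms]] by (fastforce simp: absv_mult)
  qed
  ultimately show ?thesis
    by (auto intro!: absv_sum_le)
qed

text \<open>The parameter \<open>ty\<close> ties the locale to the type \<open>'c\<close>, which the
  other parameter \<open>p\<close> does not mention.\<close>

locale padic_complete =
  fixes p :: nat and ty :: "'c::ultrametric_field itself"
  assumes prime: "Factorial_Ring.prime p" and odd: "odd p"
    and absv_p: "absv (of_nat p :: 'c) = 1 / real p"
    and complete: "complete (UNIV :: 'c set)"
begin

lemma p_ge_3: "p \<ge> 3"
  using prime odd prime_ge_2_nat[of p] by (cases "p = 2") auto

lemma inverse_p: "0 < 1 / real p" "1 / real p < 1" "(1 / real p) ^ Suc k \<le> 1 / real p"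
proof -
  show p: "0 < 1 / real p" "1 / real p < 1"
    using p_ge_3 by auto
  have "(1 / real p) ^ k \<le> 1"
    using p by (intro power_le_one) auto
  then show "(1 / real p) ^ Suc k \<le> 1 / real p"
    using mult_left_mono[of "(1 / real p) ^ k" 1 "1 / real p"] p by simp
qed

section \<open>Absolute values of integers and residues modulo p\<close>

lemma absv_of_int_le_inverse_p:
  assumes "int p dvd n"
  shows "absv (of_int n :: 'c) \<le> 1 / real p"
proof -
  obtain k where "n = int p * k"
    using assms by auto
  then have "absv (of_int n :: 'c) = 1 / real p * absv (of_int k :: 'c)"
    by (simp add: absv_mult absv_p)
  then show ?thesis
    using absv_of_int_le_1[of k, where ?'a = 'c] p_ge_3 by (simp add: divide_right_mono)
qed

text \<open>In a Bezout relation u p + v n = 1 the first summand has absolute value below 1, so the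
  second must reach 1.\<close>

lemma absv_of_int_eq_1:
  assumes "\<not> int p dvd n"
  shows "absv (of_int n :: 'c) = 1"
proof -
  have "coprime (int p) n"
    using prime assms by (intro prime_imp_coprime) auto
  then obtain u v where uv: "u * int p + v * n = 1"
    using bezout_int[of "int p" n] by auto
  have "(1 :: 'c) = of_int (u * int p) + of_int v * of_int n"
    using arg_cong[OF uv, of "of_int :: int \<Rightarrow> 'c"] by simp
  then have "1 \<le> max (absv (of_int (u * int p) :: 'c)) (absv (of_int v * of_int n :: 'c))"
    using absv_add by (metis absv_1)
  moreover have "absv (of_int (u * int p) :: 'c) \<le> 1 / real p"
    by (rule absv_of_int_le_inverse_p) simp
  then have "absv (of_int (u * int p) :: 'c) < 1"
    using inverse_p(2) by (rule le_less_trans)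
  moreover have "absv (of_int v * of_int n :: 'c) \<le> absv (of_int n :: 'c)"
    using mult_right_mono[OF absv_of_int_le_1[of v, where ?'a = 'c]] by (simp add: absv_mult)
  ultimately show ?thesis
    using absv_of_int_le_1[of n, where ?'a = 'c] by linarith
qed

lemma absv_of_nat_eq_1: "\<not> p dvd n \<Longrightarrow> absv (of_nat n :: 'c) = 1"
  using absv_of_int_eq_1[of "int n"] by simp

lemma absv_of_int_eq_powi:
  assumes "n \<noteq> 0"
  obtains v :: int where "absv (of_int n :: 'c) = real p powi v"
proof -
  obtain m where m: "n = int p ^ multiplicity (int p) n * m" "\<not> int p dvd m"
    using assms prime by (rule_tac multiplicity_decompose'[of n "int p"]) auto
  have "absv (of_int n :: 'c) = (1 / real p) ^ multiplicity (int p) n"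
    by (subst m(1)) (simp add: absv_mult absv_power absv_p absv_of_int_eq_1[OF m(2)])
  then have "absv (of_int n :: 'c) = real p powi (- int (multiplicity (int p) n))"
    by (simp add: power_int_minus power_one_over inverse_eq_divide)
  then show ?thesis
    by (rule that)
qed

text \<open>A rational closer to \<open>y\<close> than \<open>absv y\<close> has the same absolute
  value, so passing to the closure adds no new values. This discreteness makes
  \<open>padic_val\<close> meaningful and turns |x| > 1 into |x| \<ge> p.\<close>

lemma absv_padic_rats_eq_powi:
  assumes "y \<in> padic_rats" "y \<noteq> (0 :: 'c)"
  obtains v :: int where "absv y = real p powi v"
proof -
  obtain q where q: "q \<in> \<rat>" "dist q y < absv y"
    using assms unfolding padic_rats_def closure_approachable by (metis absv_pos_iff)
  then have "absv (y + (q - y)) = absv y"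
    by (intro absv_add_eq) (simp add: dist_absv)
  then have eq: "absv q = absv y"
    by simp
  obtain a b where ab: "b > 0" "q = of_int a / of_int b"
    using q(1) by (rule Rats_cases')
  then have "a \<noteq> 0"
    using eq assms by auto
  obtain v w where "absv (of_int a :: 'c) = real p powi v" "absv (of_int b :: 'c) = real p powi w"
    using absv_of_int_eq_powi \<open>a \<noteq> 0\<close> ab(1) by (metis less_irrefl)
  then have "absv y = real p powi (v - w)"
    using p_ge_3 by (simp add: eq[symmetric] ab absv_divide power_int_diff)
  then show ?thesis
    by (rule that)
qed

lemma padic_val_eq:
  assumes "absv (y :: 'c) = real p powi (- v)"
  shows "padic_val p y = v"
  unfolding padic_val_def
proof (rule the_equality)
  fix w
  assume "absv y = real p powi (- w)"
  then have "real p powi (- w) = real p powi (- v)"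
    using assms by simp
  then show "w = v"
    using p_ge_3 power_int_strict_increasing[of "- w" "- v" "real p"]
      power_int_strict_increasing[of "- v" "- w" "real p"]
    by (cases w v rule: linorder_cases) auto
qed (rule assms)

lemma padic_ints_near_nat:
  assumes "u \<in> padic_ints"
  obtains n :: nat where "absv (u - of_nat n :: 'c) \<le> 1 / real p"
proof -
  have "0 < 1 / real p"
    using p_ge_3 by simp
  then obtain q where q: "q \<in> \<rat>" "dist q u < 1 / real p"
    using assms unfolding padic_ints_def padic_rats_def closure_approachable by blast
  have near: "absv (u - q) \<le> 1 / real p"
    using q(2) by (simp add: dist_absv absv_minus_commute)
  then have "absv (u - q) \<le> 1"
    using inverse_p by linarith
  with assms absv_diff_le[of u 1 "u - q"] have q1: "absv q \<le> 1"
    by (simp add: padic_ints_def)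
  obtain a b where ab: "b > 0" "coprime a b" "q = of_int a / of_int b"
    using q(1) by (rule Rats_cases')
  \<comment> \<open>If p divided the denominator of the reduced fraction, the numerator would be a
    unit and |q| = 1/|b| would exceed 1.\<close>
  have b: "\<not> int p dvd b"
  proof
    assume b: "int p dvd b"
    then have "\<not> int p dvd a"
      using coprime_common_divisor[OF ab(2), of "int p"] p_ge_3 by auto
    then have "1 \<le> absv (of_int b :: 'c)"
      using q1 ab(1) by (simp add: ab(3) absv_divide absv_of_int_eq_1 divide_simps split: if_splits)
    then show False
      using absv_of_int_le_inverse_p[OF b] inverse_p(2) by linarith
  qed
  then have "coprime (int p) b"
    using prime by (intro prime_imp_coprime) auto
  then obtain d c where dc: "d * int p + c * b = 1"
    using bezout_int[of "int p" b] by auto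
  \<comment> \<open>\<open>c\<close> inverts the denominator \<open>b\<close> modulo p, so
    \<open>a * c\<close> represents the residue class of a/b; reducing it makes it a natural
    number.\<close>
  define n where "n = nat ((a * c) mod int p)"
  have n: "int n = a * c mod int p"
    using p_ge_3 by (simp add: n_def)
  have "int p dvd a * c - int n"
    unfolding n by (simp add: minus_mod_eq_mult_div)
  then have "absv (of_int (a * c - int n) :: 'c) \<le> 1 / real p"
    by (rule absv_of_int_le_inverse_p)
  moreover have "absv (q - of_int (a * c)) \<le> 1 / real p"
  proof -
    have "q - of_int (a * c) = of_int (a * (d * int p + c * b)) / of_int b - of_int (a * c)"
      unfolding dc by (simp add: ab(3))
    also have "\<dots> = of_int (a * d * int p) / of_int b"
      using ab(1) by (simp add: field_simps)
    finally have "absv (q - of_int (a * c)) = absv (of_int (a * d * int p) :: 'c)"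
      by (simp only: absv_divide absv_of_int_eq_1[OF b] div_by_1)
    then show ?thesis
      using absv_of_int_le_inverse_p[of "a * d * int p"] by simp
  qed
  ultimately have "absv ((u - q) + ((q - of_int (a * c)) + of_int (a * c - int n))) \<le> 1 / real p"
    using near by (intro absv_add_le)
  then have "absv (u - of_nat n) \<le> 1 / real p"
    by simp
  then show ?thesis
    by (rule that)
qed

section \<open>Teichmueller representatives and the bracket\<close>

lemma absv_frobenius_diff:
  assumes "u \<in> padic_ints"
  shows "absv (u ^ p - u :: 'c) \<le> 1 / real p"
proof -
  obtain n where n: "absv (u - of_nat n) \<le> 1 / real p"
    using padic_ints_near_nat[OF assms] .
  \<comment> \<open>Fermat's little theorem for a nearby natural number; it carries over to
    \<open>u\<close> because the power map does not increase distances on the unit disc.\<close>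
  have "int p dvd int n ^ p - int n"
  proof (cases "p dvd n")
    case True
    then have "int p dvd int n" "int n dvd int n ^ p"
      using p_ge_3 by (auto intro: dvd_power)
    then show ?thesis
      by (meson dvd_diff dvd_trans)
  next
    case False
    then have "[n * n ^ (p - 1) = n * 1] (mod p)"
      using fermat_theorem prime by (intro cong_scalar_left) auto
    moreover have "n * n ^ (p - 1) = n ^ p"
      using p_ge_3 by (cases p) auto
    ultimately have "[int (n ^ p) = int n] (mod int p)"
      unfolding cong_int_iff by simp
    then show ?thesis
      by (simp add: cong_iff_dvd_diff)
  qed
  from absv_of_int_le_inverse_p[OF this]
  have fermat: "absv (of_nat n ^ p - of_nat n :: 'c) \<le> 1 / real p"
    by simp
  have "absv (u ^ p - of_nat n ^ p) \<le> 1 / real p"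
    using absv_power_diff_le[of u "of_nat n" p] n assms
    by (simp add: padic_ints_def absv_of_nat_le_1)
  then have "absv ((u ^ p - of_nat n ^ p) + ((of_nat n ^ p - of_nat n) - (u - of_nat n)))
    \<le> 1 / real p"
    by (rule absv_add_le[OF _ absv_diff_le[OF fermat n]])
  then show ?thesis
    by simp
qed

text \<open>In a^p - b^p = (a - b) S the factor S differs from p b^(p-1) by at most |a - b|, so |S|
  \<le> 1/p: taking p-th powers gains one more factor 1/p.\<close>

lemma absv_power_p_diff:
  assumes "absv (a :: 'c) \<le> 1" "absv b \<le> 1" "absv (a - b) \<le> (1 / real p) ^ Suc k"
  shows "absv (a ^ p - b ^ p) \<le> (1 / real p) ^ Suc (Suc k)"
proof -
  let ?S = "\<Sum>i<p. b ^ (p - Suc i) * a ^ i"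
  have "absv (of_nat p * b ^ (p - 1)) \<le> 1 / real p * 1"
    unfolding absv_mult absv_p absv_power using assms by (intro mult_mono power_le_one) auto
  then have "absv ((?S - of_nat p * b ^ (p - 1)) + of_nat p * b ^ (p - 1)) \<le> 1 / real p"
    using absv_geometric_diff_le[OF assms(1,2), of p] assms(3) inverse_p(3)[of k] by (intro absv_add_le) linarith+
  then have "absv ?S \<le> 1 / real p"
    by simp
  then have "absv (a - b) * absv ?S \<le> (1 / real p) ^ Suc k * (1 / real p)"
    using assms by (intro mult_mono) auto
  then show ?thesis
    by (simp add: power_diff_sumr2 absv_mult)
qed

text \<open>The representative is the limit of u^(p^n). Each step of this sequence gains a factor
  1/p, and the limit is nonzero and fixed under taking p-th powers, hence a (p-1)-th root of
  unity.\<close>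

lemma teichmuller_exists:
  assumes "u \<in> padic_ints" "absv (u :: 'c) = 1"
  obtains w :: 'c where "w \<in> padic_ints" "w ^ (p - 1) = 1" "absv (w - u) \<le> 1 / real p"
proof -
  define y where "y n = u ^ (p ^ n)" for n
  have y: "y n \<in> padic_ints" "absv (y n) = 1" for n
    using padic_ints_power assms by (auto simp: y_def absv_power)
  have step: "absv (y (Suc n) - y n) \<le> (1 / real p) ^ Suc n" for n
  proof (induction n)
    case 0
    then show ?case
      using absv_frobenius_diff[OF assms(1)] by (simp add: y_def)
  next
    case (Suc n)
    have "y (Suc m) = y m ^ p" for m
      by (simp add: y_def mult.commute flip: power_mult)
    moreover have "absv (y (Suc n) ^ p - y n ^ p) \<le> (1 / real p) ^ Suc (Suc n)"
      by (rule absv_power_p_diff) (simp_all only: y Suc order_refl)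
    ultimately show ?case
      by simp
  qed
  have p1: "(\<lambda>n. (1 / real p) ^ Suc n) \<longlonglongrightarrow> 0"
    using p_ge_3 by (intro LIMSEQ_Suc LIMSEQ_realpow_zero) auto
  have "summable (\<lambda>n. y (Suc n) - y n)"
    by (rule ultrametric_summable[OF complete])
      (rule Lim_null_comparison[OF _ p1], use step in auto)
  then obtain d where d: "(\<lambda>n. y (Suc n) - y n) sums d"
    by auto
  then have "(\<lambda>n. y n - y 0) \<longlonglongrightarrow> d"
    by (simp add: sums_def sum_lessThan_telescope)
  then have "(\<lambda>n. y n - y 0 + y 0) \<longlonglongrightarrow> d + y 0"
    by (intro tendsto_add tendsto_const)
  then have lim: "y \<longlonglongrightarrow> d + u"
    by (simp add: y_def[of 0])
  have "absv d \<le> 1 / real p"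
  proof (rule absv_sums_le[OF d])
    show "absv (y (Suc n) - y n) \<le> 1 / real p" for n
      using step inverse_p(3) by (rule order_trans)
  qed
  moreover have "d + u \<in> padic_ints"
    using padic_ints_LIMSEQ y(1) lim by blast
  moreover have "(d + u) ^ (p - 1) = 1"
  proof -
    have "(\<lambda>n. y n ^ p) \<longlonglongrightarrow> (d + u) ^ p"
      by (intro tendsto_power_strong lim tendsto_const)
    moreover have "y n ^ p = y (Suc n)" for n
      by (simp add: y_def mult.commute flip: power_mult)
    ultimately have "(\<lambda>n. y (Suc n)) \<longlonglongrightarrow> (d + u) ^ p"
      by simp
    then have "(d + u) ^ p = d + u"
      using LIMSEQ_Suc[OF lim] by (rule LIMSEQ_unique)
    moreover have "absv (d + u) = 1"
      using LIMSEQ_unique[OF tendsto_absv[OF lim]] y(2) by simp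
    then have "d + u \<noteq> 0"
      by force
    moreover have "(d + u) ^ p = (d + u) * (d + u) ^ (p - 1)"
      using p_ge_3 by (cases p) auto
    ultimately show ?thesis
      by simp
  qed
  ultimately show ?thesis
    using that[of "d + u"] by simp
qed

lemma absv_root_of_unity:
  assumes "(w :: 'c) ^ (p - 1) = 1"
  shows "absv w = 1"
proof -
  have "absv w ^ (p - 1) = 1"
    using assms by (simp flip: absv_power)
  then show ?thesis
    using p_ge_3 power_eq_imp_eq_base[of "absv w" "p - 1" 1] by simp
qed

text \<open>The cofactor S in w^(p-1) - w'^(p-1) = (w - w') S is within |w - w'| < 1 of (p-1)
  w'^(p-2), which has absolute value 1. So S is not zero, while the product is.\<close>

lemma root_of_unity_unique:
  assumes "(w :: 'c) ^ (p - 1) = 1" "w' ^ (p - 1) = 1" "absv (w - w') < 1"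
  shows "w = w'"
proof -
  let ?S = "\<Sum>i<p - 1. w' ^ (p - 1 - Suc i) * w ^ i"
  let ?m = "of_nat (p - 1) * w' ^ (p - 1 - 1)"
  have "\<not> p dvd p - 1"
    using p_ge_3 by (auto dest: dvd_imp_le)
  then have m: "absv ?m = 1"
    unfolding absv_mult absv_power absv_root_of_unity[OF assms(2)]
    by (subst absv_of_nat_eq_1) simp_all
  have "absv (?S - ?m) \<le> absv (w - w')"
    by (rule absv_geometric_diff_le) (use absv_root_of_unity assms(1,2) in auto)
  then have "absv (?S - ?m) < absv ?m"
    unfolding m using assms(3) by linarith
  then have "absv (?m + (?S - ?m)) = absv ?m"
    by (rule absv_add_eq)
  then have "?S \<noteq> 0"
    using m by auto
  moreover have "(w - w') * ?S = 0"
    using power_diff_sumr2[of w "p - 1" w'] assms by simp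
  ultimately show ?thesis
    by simp
qed

lemma teichmuller_eq:
  assumes "u \<in> padic_ints" "w \<in> padic_ints" "w ^ (p - 1) = 1" "absv (w - u :: 'c) \<le> 1 / real p"
  shows "teichmuller p u = w"
  unfolding teichmuller_def
proof (rule the_equality)
  have "(w - u) / of_nat p \<in> padic_ints"
  proof -
    have "(w - u) * (1 / of_nat p) \<in> padic_rats"
      using assms Rats_subset_padic_rats
      by (intro padic_rats_ops) (auto simp: padic_ints_def)
    moreover have "absv ((w - u) / of_nat p) \<le> 1"
      using assms(4) p_ge_3 by (simp add: absv_divide absv_p field_simps)
    ultimately show ?thesis
      by (simp add: padic_ints_def)
  qed
  then show "w \<in> padic_ints \<and> w ^ (p - 1) = 1 \<and> (\<exists>z\<in>padic_ints. w - u = of_nat p * z)"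
    using assms p_ge_3 by (intro conjI bexI[of _ "(w - u) / of_nat p"]) auto
next
  fix v
  assume v: "v \<in> padic_ints \<and> v ^ (p - 1) = 1 \<and> (\<exists>z\<in>padic_ints. v - u = of_nat p * z)"
  then have "absv (v - u) \<le> 1 / real p"
    using p_ge_3 by (auto simp: absv_mult absv_p padic_ints_def divide_simps)
  then have "absv (v - u - (w - u)) \<le> 1 / real p"
    using assms(4) by (rule absv_diff_le)
  then have "absv (v - w) < 1"
    using inverse_p(2) by (simp add: le_less_trans del: divide_less_eq_1_pos)
  then show "v = w"
    by (rule root_of_unity_unique[rotated 2]) (use v assms(3) in auto)
qed

text \<open>Multiplying by 1 + h preserves the absolute value, hence the valuation, and leaves the
  unit part unchanged modulo p, hence its Teichmueller representative. Both denominators in the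
  bracket therefore stay the same.\<close>

lemma padic_bracket:
  assumes "y \<in> padic_rats" "y \<noteq> (0 :: 'c)"
  shows "absv (padic_bracket p y - 1) \<le> 1 / real p"
    and "\<And>h. absv h \<le> 1 / real p \<Longrightarrow> y * (1 + h) \<in> padic_rats \<Longrightarrow>
           padic_bracket p (y * (1 + h)) = padic_bracket p y * (1 + h)"
proof -
  obtain v' where "absv y = real p powi v'"
    using absv_padic_rats_eq_powi assms by blast
  then obtain v where v: "absv y = real p powi (- v)"
    by (metis minus_minus)
  \<comment> \<open>Formulated for every z with the absolute value of \<open>y\<close>, since it is
    applied to \<open>y\<close> and to \<open>y * (1 + h)\<close>.\<close>
  have unit: "z / of_nat p powi v \<in> padic_ints \<and> absv (z / of_nat p powi v) = 1"
    if z: "z \<in> padic_rats" "absv (z :: 'c) = absv y" for z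
  proof -
    have "(1 / of_nat p powi v :: 'c) \<in> \<rat>"
      by (cases v rule: int_cases3) (auto simp: power_int_minus)
    then have "z * (1 / of_nat p powi v) \<in> padic_rats"
      using Rats_subset_padic_rats z by (intro padic_rats_ops) auto
    moreover have "absv (of_nat p powi v :: 'c) = real p powi (- v)"
      by (cases v rule: int_cases3)
        (auto simp: power_int_minus absv_power absv_inverse absv_divide absv_p power_one_over
          inverse_eq_divide)
    then have "absv (z / of_nat p powi v) = 1"
      using z v p_ge_3 by (simp add: absv_divide)
    ultimately show ?thesis
      by (simp add: padic_ints_def)
  qed
  define u where "u = y / of_nat p powi v"
  have u: "u \<in> padic_ints" "absv u = 1"
    using unit[OF assms(1)] by (auto simp: u_def)
  obtain w where w: "w \<in> padic_ints" "w ^ (p - 1) = 1" "absv (w - u) \<le> 1 / real p"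
    using teichmuller_exists[OF u] .
  then have br: "padic_bracket p y = u / w"
    using teichmuller_eq[OF u(1) w] padic_val_eq[OF v] by (simp add: padic_bracket_def u_def)
  have aw: "absv w = 1"
    using absv_root_of_unity w by blast
  then have "w \<noteq> 0"
    by auto
  then have "padic_bracket p y - 1 = (u - w) / w"
    by (simp add: br field_simps)
  then show "absv (padic_bracket p y - 1) \<le> 1 / real p"
    using w(3) by (simp add: absv_divide aw absv_minus_commute)
  fix h :: 'c
  assume h: "absv h \<le> 1 / real p" "y * (1 + h) \<in> padic_rats"
  have "1 / real p < 1"
    using p_ge_3 by simp
  then have "absv (1 + h) = absv (1 :: 'c)"
    using h by (intro absv_add_eq) auto
  then have z: "absv (y * (1 + h)) = absv y"
    by (simp add: absv_mult)
  define u' where "u' = y * (1 + h) / of_nat p powi v"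
  have u': "u' \<in> padic_ints"
    using unit[OF h(2) z] by (auto simp: u'_def)
  have "absv (w - u - u * h) \<le> 1 / real p"
    using w(3) h(1) by (intro absv_diff_le[of "w - u"]) (auto simp: absv_mult u)
  moreover have "w - u' = w - u - u * h"
    by (simp add: u_def u'_def algebra_simps add_divide_distrib)
  ultimately have "absv (w - u') \<le> 1 / real p"
    by (simp only:)
  then have "teichmuller p u' = w"
    by (rule teichmuller_eq[OF u' w(1,2)])
  then have "padic_bracket p (y * (1 + h)) = u' / w"
    using padic_val_eq[of "y * (1 + h)" v] z v by (simp add: padic_bracket_def u'_def)
  then show "padic_bracket p (y * (1 + h)) = padic_bracket p y * (1 + h)"
    by (simp add: br u_def u'_def)
qed

section \<open>The power function\<close>

text \<open>The reciprocal of the radius of convergence of the p-adic exponential series. It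
  satisfies r^(p-1) = p, which is what the factorial estimate needs.\<close>

abbreviation r :: real where
  "r \<equiv> real p powr (1 / (real p - 1))"

lemma r_ge_1: "1 \<le> r"
  using p_ge_3 by (intro ge_one_powr_ge_zero) auto

lemma r_power: "r ^ (p - 1) = real p"
proof -
  have "r ^ (p - 1) = real p powr (1 / (real p - 1) * real (p - 1))"
    using p_ge_3 by (subst powr_realpow[symmetric]) (auto simp: powr_powr)
  then show ?thesis
    using p_ge_3 by (simp add: of_nat_diff)
qed

lemma padic_radius_eq: "padic_radius p = real p / r"
proof -
  have "(real p - 2) / (real p - 1) = 1 - 1 / (real p - 1)"
    using p_ge_3 by (simp add: divide_simps)
  then show ?thesis
    using p_ge_3 by (simp add: padic_radius_def powr_diff)
qed

lemma padic_radius_gt_1: "1 < padic_radius p"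
  using p_ge_3 unfolding padic_radius_def by (intro gr_one_powr) auto

text \<open>One step of Legendre's formula: among the factors 1, ..., p q + t only p, 2p, ..., q p
  are not units, and their product is p^q q!.\<close>

lemma absv_fact_decompose:
  assumes "t < p"
  shows "absv (fact (p * q + t) :: 'c) = (1 / real p) ^ q * absv (fact q :: 'c)"
proof -
  have shift: "absv (fact (p * q + t) :: 'c) = absv (fact (p * q) :: 'c)" if "t < p" for q t
    using that
  proof (induction t)
    case (Suc t)
    have "\<not> p dvd Suc t"
      using Suc.prems by (auto dest: dvd_imp_le)
    then have "\<not> p dvd p * q + Suc t"
      by (subst dvd_add_right_iff) auto
    then have "absv (of_nat (p * q + Suc t) :: 'c) = 1"
      by (rule absv_of_nat_eq_1)
    moreover have "(fact (p * q + Suc t) :: 'c) = of_nat (p * q + Suc t) * fact (p * q + t)"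
      by (simp only: add_Suc_right fact_Suc)
    ultimately show ?case
      using Suc by (simp add: absv_mult)
  qed simp
  have "absv (fact (p * q) :: 'c) = (1 / real p) ^ q * absv (fact q :: 'c)"
  proof (induction q)
    case (Suc q)
    have "p * Suc q = Suc (p * q + (p - 1))"
      using p_ge_3 by simp
    then have "(fact (p * Suc q) :: 'c) = of_nat (p * Suc q) * fact (p * q + (p - 1))"
      by (metis fact_Suc)
    then have "absv (fact (p * Suc q) :: 'c)
      = 1 / real p * absv (of_nat (Suc q) :: 'c) * absv (fact (p * q + (p - 1)) :: 'c)"
      by (simp only: absv_mult of_nat_mult absv_p)
    also have "absv (fact (p * q + (p - 1)) :: 'c) = (1 / real p) ^ q * absv (fact q :: 'c)"
      using shift[of "p - 1" q] Suc p_ge_3 by simp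
    also have "1 / real p * absv (of_nat (Suc q) :: 'c) * ((1 / real p) ^ q * absv (fact q :: 'c))
      = (1 / real p) ^ Suc q * absv (fact (Suc q) :: 'c)"
      by (simp only: fact_Suc absv_mult power_Suc mult_ac)
    finally show ?case .
  qed simp
  with shift[OF assms] show ?thesis
    by simp
qed

lemma inverse_absv_fact_le: "1 / absv (fact k :: 'c) \<le> r ^ k"
proof (induction k rule: less_induct)
  case (less k)
  show ?case
  proof (cases "k = 0")
    case False
    define q where "q = k div p"
    have k: "k = p * q + k mod p"
      by (simp add: q_def)
    have "q < k"
      using False p_ge_3 by (simp add: q_def)
    have "absv (fact k :: 'c) = (1 / real p) ^ q * absv (fact q :: 'c)"
      using absv_fact_decompose[of "k mod p" q] p_ge_3 k by simp
    then have "1 / absv (fact k :: 'c) = real p ^ q * (1 / absv (fact q :: 'c))"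
      by (simp add: power_one_over)
    also have "\<dots> \<le> real p ^ q * r ^ q"
      using less[OF \<open>q < k\<close>] by (intro mult_left_mono) auto
    \<comment> \<open>Writing p as r^(p-1) merges the gain p^q with the inductive bound r^q into
      r^(p q), whose exponent is at most k.\<close>
    also have "\<dots> = (r ^ (p - 1) * r) ^ q"
      by (simp only: r_power power_mult_distrib)
    also have "r ^ (p - 1) * r = r ^ p"
      using p_ge_3 by (cases p) simp_all
    also have "(r ^ p) ^ q = r ^ (p * q)"
      by (simp add: power_mult)
    also have "\<dots> \<le> r ^ k"
      using r_ge_1 by (intro power_increasing) (simp_all add: q_def)
    finally show ?thesis .
  qed simp
qed

text \<open>Used with \<open>b i\<close> = (u - 1)^i for the powers and with \<open>b i\<close> =
  E_i(0)/x^i for the final series. The i-th polynomial has coefficients of size at most B p^(-i) r^i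
  = B / R_p^i.\<close>

lemma gchoose_series:
  fixes b :: "nat \<Rightarrow> 'c"
  assumes "\<And>i. absv (b i) \<le> B / real p ^ i"
  shows "absv s < padic_radius p \<Longrightarrow> summable (\<lambda>i. ((1 - s) gchoose i) * b i)"
    and "padic_analytic_on_disc (padic_radius p) (\<lambda>s. \<Sum>i. ((1 - s) gchoose i) * b i)"
proof -
  define Q where "Q i = Polynomial.smult (b i) (gchoose_poly i)" for i
  have "0 \<le> B"
    using order_trans[OF absv_nonneg assms[of 0]] by simp
  have deg: "Polynomial.degree (Q i) \<le> i" for i
    using degree_gchoose_poly[of i, where ?'a = 'c] by (simp add: Q_def)
  have "absv (Polynomial.coeff (Q i) n) \<le> B / padic_radius p ^ i" for i n
  proof -
    have "absv (Polynomial.coeff (Q i) n) \<le> B / real p ^ i * (1 / absv (fact i :: 'c))"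
      unfolding Q_def Polynomial.coeff_smult absv_mult
      using \<open>0 \<le> B\<close> by (intro mult_mono assms absv_coeff_gchoose_poly) auto
    also have "\<dots> \<le> B / real p ^ i * r ^ i"
      using \<open>0 \<le> B\<close> by (intro mult_left_mono inverse_absv_fact_le) auto
    finally show ?thesis
      by (simp add: padic_radius_eq power_divide)
  qed
  note series = padic_analytic_poly_series[OF complete padic_radius_gt_1 deg this]
  have "poly (Q i) s = ((1 - s) gchoose i) * b i" for i s
    by (simp add: Q_def poly_gchoose_poly)
  with series show "absv s < padic_radius p \<Longrightarrow> summable (\<lambda>i. ((1 - s) gchoose i) * b i)"
    and "padic_analytic_on_disc (padic_radius p) (\<lambda>s. \<Sum>i. ((1 - s) gchoose i) * b i)"
    by simp_all
qed

section \<open>Powers of elements congruent to 1 modulo p\<close>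

lemma padic_power_terms:
  assumes "absv (u - 1 :: 'c) \<le> 1 / real p"
  shows "absv ((u - 1) ^ k) \<le> 1 / real p ^ k"
  using power_mono[OF assms absv_nonneg, of k] by (simp add: absv_power power_one_over)

lemma padic_power_sums:
  assumes "absv (u - 1 :: 'c) \<le> 1 / real p" "absv s < padic_radius p"
  shows "(\<lambda>k. ((1 - s) gchoose k) * (u - 1) ^ k) sums padic_power u (1 - s)"
  unfolding padic_power_def
  using gchoose_series(1)[OF padic_power_terms[OF assms(1)] assms(2)] by (rule summable_sums)

lemma padic_power_analytic:
  assumes "absv (u - 1 :: 'c) \<le> 1 / real p"
  shows "padic_analytic_on_disc (padic_radius p) (\<lambda>s. padic_power u (1 - s))"
  unfolding padic_power_def by (rule gchoose_series(2)[OF padic_power_terms[OF assms]])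

lemma padic_power_of_nat: "padic_power (u :: 'c) (of_nat n) = u ^ n"
proof -
  have "padic_power u (of_nat n) = (\<Sum>k\<le>n. (of_nat n gchoose k) * (u - 1) ^ k)"
    unfolding padic_power_def
    by (rule suminf_finite) (auto simp: binomial_gbinomial[symmetric] binomial_eq_0)
  also have "\<dots> = ((u - 1) + 1) ^ n"
    unfolding binomial_ring by (simp add: binomial_gbinomial)
  finally show ?thesis
    by simp
qed

text \<open>
  For natural exponents the claim is trivial, and the natural numbers \<open>1 - s = 1 + p\<^sup>m\<close>
  accumulate at \<open>s = 0\<close>, so the identity theorem applies.
\<close>

lemma padic_power_mult:
  assumes u: "absv (u - 1 :: 'c) \<le> 1 / real p" and w: "absv (w - 1) \<le> 1 / real p"
    and s: "absv s < padic_radius p"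
  shows "padic_power (u * w) (1 - s) = padic_power u (1 - s) * padic_power w (1 - s)"
proof -
  define f where
    "f s = padic_power (u * w) (1 - s) - padic_power u (1 - s) * padic_power w (1 - s)" for s
  define z where "z m = - (of_nat (p ^ m) :: 'c)" for m
  have "absv u \<le> 1"
    using absv_add_le[of "u - 1" 1 1] u inverse_p(2) by simp
  then have "absv (u * (w - 1)) \<le> 1 / real p"
    using mult_mono[of "absv u" 1 "absv (w - 1)" "1 / real p"] w by (simp add: absv_mult)
  then have "absv (u * (w - 1) + (u - 1)) \<le> 1 / real p"
    using u by (rule absv_add_le)
  then have uw: "absv (u * w - 1) \<le> 1 / real p"
    by (simp add: algebra_simps)
  have "padic_analytic_on_disc (padic_radius p) f"
    unfolding f_def
    by (intro padic_analytic_on_disc_diff padic_analytic_on_disc_mult complete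
        padic_power_analytic u w uw)
  moreover have z: "absv (z m) = (1 / real p) ^ m" for m
    by (simp add: z_def absv_power absv_p)
  have "z \<longlonglongrightarrow> 0"
    unfolding tendsto_absv_iff using inverse_p by (simp add: z LIMSEQ_realpow_zero)
  moreover have "z m \<noteq> 0" for m
    using p_ge_3 by (simp add: z_def)
  moreover have "absv (z m) \<le> 1" for m
    using inverse_p by (simp add: z power_le_one)
  moreover have "f (z m) = 0" for m
  proof -
    have "1 - z m = of_nat (1 + p ^ m)"
      by (simp add: z_def)
    then show ?thesis
      unfolding f_def by (simp only: padic_power_of_nat power_mult_distrib) simp
  qed
  ultimately have "f s = 0"
    using padic_analytic_identity padic_radius_gt_1 s by blast
  then show ?thesis
    by (simp add: f_def)
qed

end

section \<open>Fermionic integrals of power series\<close>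

definition euler_fps :: "'a::field_char_0 fps" where
  "euler_fps = 2 / (fps_exp 1 + 1)"

lemma euler_fps_mult: "euler_fps * (fps_exp 1 + 1) = (2 :: 'a::field_char_0 fps)"
proof -
  have "(fps_exp 1 + 1 :: 'a fps) $ 0 \<noteq> 0"
    by simp
  then show ?thesis
    by (simp add: euler_fps_def fps_divide_unit mult.assoc inverse_mult_eq_1)
qed

lemma fps_nth_euler_fps: "euler_fps $ m = euler_poly m 0 / fact m"
  by (simp add: euler_fps_def euler_poly_def)

text \<open>The left side is E_n(x). Once k = n is split off, every remaining term contains a
  positive power of x: x = 1 gives the recurrence for E_n(0), and x = p^N gives the error of the
  alternating sum.\<close>

lemma fact_mult_nth_euler_fps_exp:
  "fact n * (euler_fps * fps_exp x :: 'a::field_char_0 fps) $ n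
    = euler_poly n 0 + (\<Sum>k<n. of_nat (n choose k) * (euler_poly k 0 * x ^ (n - k)))"
proof -
  have "fact n * (euler_fps * fps_exp x :: 'a fps) $ n
    = (\<Sum>k\<le>n. fact n * (euler_poly k 0 / fact k * (x ^ (n - k) / fact (n - k))))"
    by (simp add: fps_mult_nth fps_nth_euler_fps sum_distrib_left atLeast0AtMost)
  also have "\<dots> = (\<Sum>k\<le>n. of_nat (n choose k) * (euler_poly k 0 * x ^ (n - k)))"
    by (intro sum.cong) (auto simp: binomial_fact)
  also have "{..n} = insert n {..<n}"
    by auto
  finally show ?thesis
    by simp
qed

lemma euler_poly_recurrence:
  "2 * euler_poly n (0 :: 'a::field_char_0)
    = (if n = 0 then 2 else 0) - (\<Sum>k<n. of_nat (n choose k) * euler_poly k 0)"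
proof -
  let ?G = "euler_fps :: 'a fps"
  have "fact n * (?G * fps_exp 1) $ n + fact n * ?G $ n = fact n * (2 :: 'a fps) $ n"
    using arg_cong[OF euler_fps_mult, of "\<lambda>f. fact n * f $ n"] by (simp add: distrib_left)
  then have "euler_poly n 0 + (\<Sum>k<n. of_nat (n choose k) * euler_poly k 0) + euler_poly n 0
    = fact n * (2 :: 'a fps) $ n"
    unfolding fact_mult_nth_euler_fps_exp by (simp add: fps_nth_euler_fps)
  then show ?thesis
    by (auto simp: fps_numeral_nth algebra_simps)
qed

text \<open>A finite geometric series with ratio -e^t, with the denominator cleared.\<close>

lemma alternating_exp_sum:
  "(fps_exp 1 + 1) * (\<Sum>a<n. (- 1) ^ a * fps_exp (of_nat a))
    = 1 - (- 1) ^ n * fps_exp (of_nat n :: 'a::field_char_0)"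
proof (induction n)
  case (Suc n)
  have "fps_exp (of_nat (Suc n) :: 'a) = fps_exp 1 * fps_exp (of_nat n)"
    by (simp flip: fps_exp_add_mult)
  then show ?case
    using Suc by (simp only: sum.lessThan_Suc distrib_left) (simp add: algebra_simps)
qed simp

text \<open>For odd n the geometric series has numerator 1 + e^(nt), so twice the alternating sum of
  a^i is E_i(0) + E_i(n). Subtracting 2 E_i(0) leaves only terms with positive powers of n.\<close>

lemma alternating_power_sum:
  assumes "odd n"
  shows "2 * ((\<Sum>a<n. (- 1) ^ a * of_nat a ^ i) - euler_poly i 0)
    = (\<Sum>k<i. of_nat (i choose k) * (euler_poly k 0 * of_nat n ^ (i - k) :: 'a::field_char_0))"
proof -
  let ?G = "euler_fps :: 'a fps"
  let ?S = "\<Sum>a<n. (- 1) ^ a * fps_exp (of_nat a) :: 'a fps"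
  have "2 * ?S = ?G * ((fps_exp 1 + 1) * ?S)"
    using euler_fps_mult[where ?'a = 'a] by (simp only: mult.assoc[symmetric])
  also have "\<dots> = ?G + ?G * fps_exp (of_nat n)"
    unfolding alternating_exp_sum using assms by (simp add: distrib_left)
  finally have main: "fact i * (2 * ?S) $ i = fact i * ?G $ i + fact i * (?G * fps_exp (of_nat n)) $ i"
    by (simp add: distrib_left)
  have "((- 1) ^ a * F) $ i = (- 1) ^ a * F $ i" for a and F :: "'a fps"
    by (cases "even a") auto
  then have "fact i * ?S $ i = (\<Sum>a<n. (- 1) ^ a * of_nat a ^ i)"
    by (simp add: fps_sum_nth sum_distrib_left)
  moreover have "(2 * F) $ i = 2 * F $ i" for F :: "'a fps"
    by (simp add: numeral_fps_const)
  ultimately have "fact i * (2 * ?S) $ i = 2 * (\<Sum>a<n. (- 1) ^ a * of_nat a ^ i)"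
    by (simp only: mult.left_commute[of "fact i" 2])
  with main show ?thesis
    unfolding fact_mult_nth_euler_fps_exp by (simp add: fps_nth_euler_fps algebra_simps)
qed

lemma absv_derivative_remainder_le:
  fixes a b :: "'c::ultrametric_field"
  assumes "absv a \<le> 1" "absv b \<le> 1" "a \<noteq> b"
  shows "absv ((b ^ n - a ^ n) / (b - a) - of_nat n * a ^ (n - 1)) \<le> dist a b"
proof -
  have "(b ^ n - a ^ n) / (b - a) = (\<Sum>i<n. a ^ (n - Suc i) * b ^ i)"
    using assms(3) by (simp add: power_diff_sumr2)
  then show ?thesis
    using absv_geometric_diff_le[OF assms(2,1), of n] by (simp add: dist_absv absv_minus_commute)
qed

text \<open>The derivative is taken term by term. In every term the difference quotient misses it by
  at most C |a - b|, a bound independent of the index and hence valid for the sum, so the choice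
  \<delta> = \<epsilon> / C works throughout.\<close>

lemma power_series_uniformly_differentiable:
  fixes f :: "'c::ultrametric_field \<Rightarrow> 'c"
  assumes complete: "complete (UNIV :: 'c set)" and null: "(\<lambda>i. absv (c i)) \<longlonglongrightarrow> 0"
    and f: "\<And>a. a \<in> padic_ints \<Longrightarrow> (\<lambda>i. c i * a ^ i) sums f a"
  shows "uniformly_differentiable_on padic_ints f"
proof -
  have "Bseq (\<lambda>n. absv (c n))"
    using null by (intro convergent_imp_Bseq convergentI)
  then obtain C where C: "0 < C" "\<And>n. absv (c n) \<le> C"
    by (auto simp: Bseq_def)
  \<comment> \<open>At \<open>i = 0\<close> the truncated exponent \<open>i - 1\<close> is harmless
    because the factor \<open>of_nat i\<close> vanishes.\<close>
  define f' where "f' a = (\<Sum>i. c i * (of_nat i * a ^ (i - 1)))" for a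
  have f': "(\<lambda>i. c i * (of_nat i * a ^ (i - 1))) sums f' a" if "a \<in> padic_ints" for a
    unfolding f'_def
  proof (intro summable_sums ultrametric_summable[OF complete])
    show "(\<lambda>i. absv (c i * (of_nat i * a ^ (i - 1)))) \<longlonglongrightarrow> 0"
    proof (rule Lim_null_comparison[OF _ null])
      have "absv (of_nat i * a ^ (i - 1)) \<le> 1" for i
        unfolding absv_mult absv_power using that
        by (intro mult_le_one absv_of_nat_le_1 power_le_one) (auto simp: padic_ints_def)
      then have "absv (c i) * absv (of_nat i * a ^ (i - 1)) \<le> absv (c i) * 1" for i
        by (intro mult_left_mono) auto
      then show "\<forall>\<^sub>F i in sequentially. norm (absv (c i * (of_nat i * a ^ (i - 1)))) \<le> absv (c i)"
        by (simp add: absv_mult)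
    qed
  qed
  have "absv ((f b - f a) / (b - a) - f' a) \<le> C * dist a b"
    if "a \<in> padic_ints" "b \<in> padic_ints" "a \<noteq> b" for a b
  proof (rule absv_sums_le)
    have "(\<lambda>i. 1 / (b - a) * (c i * b ^ i - c i * a ^ i) - c i * (of_nat i * a ^ (i - 1)))
      sums (1 / (b - a) * (f b - f a) - f' a)"
      using that by (intro ultrametric_sums_diff sums_cmult f f')
    moreover have "1 / (b - a) * (c i * b ^ i - c i * a ^ i) - c i * (of_nat i * a ^ (i - 1))
      = c i * ((b ^ i - a ^ i) / (b - a) - of_nat i * a ^ (i - 1))" for i
      by (simp add: right_diff_distrib diff_divide_distrib)
    ultimately show "(\<lambda>i. c i * ((b ^ i - a ^ i) / (b - a) - of_nat i * a ^ (i - 1)))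
      sums ((f b - f a) / (b - a) - f' a)"
      by simp
    show "absv (c i * ((b ^ i - a ^ i) / (b - a) - of_nat i * a ^ (i - 1))) \<le> C * dist a b" for i
      unfolding absv_mult using C that
      by (intro mult_mono absv_derivative_remainder_le) (auto simp: padic_ints_def)
  qed
  then have close: "absv ((f b - f a) / (b - a) - f' a) < e"
    if "a \<in> padic_ints" "b \<in> padic_ints" "a \<noteq> b" "dist a b < e / C" for a b e
    using that C(1) by (force simp: field_simps)
  show ?thesis
    unfolding uniformly_differentiable_on_def
  proof (intro exI[of _ f'] allI impI)
    fix e :: real
    assume "0 < e"
    then show "\<exists>d>0. \<forall>a\<in>padic_ints. \<forall>b\<in>padic_ints. a \<noteq> b \<and> dist a b < d \<longrightarrow>
        absv ((f b - f a) / (b - a) - f' a) < e"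
      using C(1) close by (intro exI[of _ "e / C"]) simp
  qed
qed

context padic_complete
begin

section \<open>Integrality of E_n(0) and term-by-term integration\<close>

lemma absv_2: "absv (2 :: 'c) = 1"
proof -
  have "\<not> p dvd 2"
    using p_ge_3 by (auto dest: dvd_imp_le)
  from absv_of_nat_eq_1[OF this] show ?thesis
    by simp
qed

text \<open>The recurrence writes 2 E_n(0) as an integer combination of earlier values and the
  constant 2 or 0, and division by 2 does not change the absolute value.\<close>

lemma absv_euler_poly_le: "absv (euler_poly n 0 :: 'c) \<le> 1"
proof (induction n rule: less_induct)
  case (less n)
  have "absv (\<Sum>k<n. of_nat (n choose k) * euler_poly k 0 :: 'c) \<le> 1"
    using less by (intro absv_sum_le) (auto simp: absv_mult intro!: mult_le_one absv_of_nat_le_1)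
  moreover have "absv (if n = 0 then 2 else 0 :: 'c) \<le> 1"
    by (simp add: absv_2)
  ultimately have "absv (2 * euler_poly n 0 :: 'c) \<le> 1"
    unfolding euler_poly_recurrence by (intro absv_diff_le)
  then show ?case
    by (simp add: absv_mult absv_2)
qed

lemma absv_alternating_power_sum_le:
  "absv ((\<Sum>a<p ^ N. (- 1) ^ a * of_nat a ^ i) - euler_poly i 0 :: 'c) \<le> (1 / real p) ^ N"
proof -
  have "absv (of_nat (i choose k) * (euler_poly k 0 * of_nat (p ^ N) ^ (i - k)) :: 'c)
      \<le> (1 / real p) ^ N" if "k < i" for k
  proof -
    have q: "absv (of_nat (p ^ N) :: 'c) = (1 / real p) ^ N" "(1 / real p) ^ N \<le> 1"
      using inverse_p by (auto simp: absv_power absv_p intro!: power_le_one)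
    then have "absv (of_nat (p ^ N) ^ (i - k) :: 'c) \<le> (1 / real p) ^ N"
      unfolding absv_power q(1) using power_decreasing[of 1 "i - k" "(1 / real p) ^ N"] that by simp
    moreover have "absv (of_nat (i choose k) * euler_poly k 0 :: 'c) \<le> 1"
      unfolding absv_mult by (intro mult_le_one absv_of_nat_le_1 absv_euler_poly_le) auto
    ultimately show ?thesis
      unfolding mult.assoc[symmetric] absv_mult[of "_ * _"]
      using mult_mono[of _ 1 _ "(1 / real p) ^ N"] by fastforce
  qed
  then have "absv (2 * ((\<Sum>a<p ^ N. (- 1) ^ a * of_nat a ^ i) - euler_poly i 0) :: 'c)
    \<le> (1 / real p) ^ N"
    using odd by (subst alternating_power_sum) (auto intro!: absv_sum_le)
  then show ?thesis
    by (simp only: absv_mult absv_2 mult_1)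
qed

lemma fermionic_power_series:
  fixes c :: "nat \<Rightarrow> 'c"
  assumes null: "(\<lambda>i. absv (c i)) \<longlonglongrightarrow> 0"
    and f: "\<And>a. a \<in> padic_ints \<Longrightarrow> (\<lambda>i. c i * a ^ i) sums f a"
  shows "fermionic_integrable p f"
    and "(\<lambda>i. c i * euler_poly i 0) sums fermionic_integral p f"
proof -
  have "Bseq (\<lambda>n. absv (c n))"
    using null by (intro convergent_imp_Bseq convergentI)
  then obtain C where C: "0 < C" "\<And>n. absv (c n) \<le> C"
    by (auto simp: Bseq_def)
  have "summable (\<lambda>i. c i * euler_poly i 0)"
  proof (rule ultrametric_summable[OF complete Lim_null_comparison[OF _ null]])
    have "absv (c i) * absv (euler_poly i 0 :: 'c) \<le> absv (c i) * 1" for i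
      by (intro mult_left_mono absv_euler_poly_le) auto
    then show "\<forall>\<^sub>F i in sequentially. norm (absv (c i * euler_poly i 0)) \<le> absv (c i)"
      by (simp add: absv_mult)
  qed
  then obtain L where L: "(\<lambda>i. c i * euler_poly i 0) sums L"
    by auto
  have lim: "fermionic_sum p f \<longlonglongrightarrow> L"
  proof (rule tendsto_absvI)
    fix N
    \<comment> \<open>Exchanging the finite sum over a with the series expresses the difference as a
      series whose i-th term is \<open>c i\<close> times the error of the i-th alternating power
      sum. The error bound p^(-N) is uniform in i, so it survives the summation.\<close>
    show "absv (fermionic_sum p f N - L) \<le> C * (1 / real p) ^ N"
    proof (rule absv_sums_le)
      have "(\<lambda>i. \<Sum>a<p ^ N. (- 1) ^ a * (c i * of_nat a ^ i)) sums fermionic_sum p f N"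
        unfolding fermionic_sum_def by (intro sums_sum sums_cmult f of_nat_in_padic_ints)
      moreover have "(\<Sum>a<p ^ N. (- 1) ^ a * (c i * of_nat a ^ i))
        = c i * (\<Sum>a<p ^ N. (- 1) ^ a * of_nat a ^ i)" for i
        by (simp add: sum_distrib_left mult_ac)
      ultimately show "(\<lambda>i. c i * (\<Sum>a<p ^ N. (- 1) ^ a * of_nat a ^ i) - c i * euler_poly i 0)
        sums (fermionic_sum p f N - L)"
        using L by (intro ultrametric_sums_diff) simp_all
      show "absv (c i * (\<Sum>a<p ^ N. (- 1) ^ a * of_nat a ^ i) - c i * euler_poly i 0)
        \<le> C * (1 / real p) ^ N" for i
        unfolding right_diff_distrib[symmetric] absv_mult[of "c i"]
        using C by (intro mult_mono absv_alternating_power_sum_le) auto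
    qed
  next
    have "(\<lambda>N. C * (1 / real p) ^ N) \<longlonglongrightarrow> C * 0"
      using inverse_p by (intro tendsto_mult tendsto_const LIMSEQ_realpow_zero) auto
    then show "(\<lambda>N. C * (1 / real p) ^ N) \<longlonglongrightarrow> 0"
      by simp
  qed
  then show "fermionic_integrable p f"
    unfolding fermionic_integrable_def
    using power_series_uniformly_differentiable[OF complete null f] convergentI by blast
  show "(\<lambda>i. c i * euler_poly i 0) sums fermionic_integral p f"
    unfolding fermionic_integral_def limI[OF lim] by (rule L)
qed

end

theorem theorem3p5:
  fixes p :: nat and x :: "'c::ultrametric_field"
  assumes "Factorial_Ring.prime p" and "odd p"
    and "complex_padic_field p TYPE('c)"
    and "x \<in> padic_rats" and "x \<notin> padic_ints"
  shows "(\<forall>s::'c. absv s < padic_radius p \<longrightarrow>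
            fermionic_integrable p (\<lambda>a. padic_power (padic_bracket p (x + a)) (1 - s)) \<and>
            summable (\<lambda>i. ((1 - s) gchoose i) * euler_poly i 0 * (1 / x ^ i)) \<and>
            padic_euler_zeta p s x
              = fermionic_integral p (\<lambda>a. padic_power (padic_bracket p (x + a)) (1 - s)) \<and>
            padic_euler_zeta p s x
              = padic_power (padic_bracket p x) (1 - s)
                * (\<Sum>i. ((1 - s) gchoose i) * euler_poly i 0 * (1 / x ^ i))) \<and>
         padic_analytic_on_disc (padic_radius p) (\<lambda>s::'c. padic_euler_zeta p s x)"
proof -
  interpret padic_complete p "TYPE('c)"
    using assms by unfold_locales (auto simp: complex_padic_field_def)
  have "1 < absv x"
    using assms by (auto simp: padic_ints_def)
  then have "x \<noteq> 0"
    by auto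
  \<comment> \<open>Absolute values on Q_p are integer powers of p, so |x| > 1 already means |x|
    \<ge> p. This puts every a/x with a in Z_p into the range where the power series and the bracket
    rule are valid.\<close>
  have x: "absv (1 / x) \<le> 1 / real p"
  proof -
    obtain v where v: "absv x = real p powi v"
      using absv_padic_rats_eq_powi[OF assms(4) \<open>x \<noteq> 0\<close>] .
    have "1 \<le> v"
    proof (rule ccontr)
      assume "\<not> 1 \<le> v"
      then have "real p powi v \<le> 1"
        using power_int_increasing[of v 0 "real p"] p_ge_3 by simp
      then show False
        using v \<open>1 < absv x\<close> by simp
    qed
    then have "real p \<le> absv x"
      using power_int_increasing[of 1 v "real p"] p_ge_3 v by simp
    then show ?thesis
      using p_ge_3 by (simp add: absv_divide frac_le)
  qed
  let ?B = "padic_bracket p x"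
  note bracket = padic_bracket[OF assms(4) \<open>x \<noteq> 0\<close>]
  have b: "absv (euler_poly i 0 * (1 / x ^ i)) \<le> 1 / real p ^ i" for i
  proof -
    have "absv (euler_poly i 0 :: 'c) * absv (1 / x) ^ i \<le> 1 * (1 / real p) ^ i"
      using x by (intro mult_mono absv_euler_poly_le power_mono) auto
    then show ?thesis
      by (simp add: absv_mult absv_divide absv_power power_one_over)
  qed
  have main: "fermionic_integrable p (\<lambda>a. padic_power (padic_bracket p (x + a)) (1 - s)) \<and>
      summable (\<lambda>i. ((1 - s) gchoose i) * euler_poly i 0 * (1 / x ^ i)) \<and>
      padic_euler_zeta p s x = padic_power ?B (1 - s)
        * (\<Sum>i. ((1 - s) gchoose i) * euler_poly i 0 * (1 / x ^ i))"
    if s: "absv s < padic_radius p" for s :: 'c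
  proof -
    define c where "c i = padic_power ?B (1 - s) * (((1 - s) gchoose i) * (1 / x) ^ i)" for i
    have f: "(\<lambda>i. c i * a ^ i) sums padic_power (padic_bracket p (x + a)) (1 - s)"
      if a: "a \<in> padic_ints" for a
    proof -
      have "absv (1 / x) * absv a \<le> 1 / real p * 1"
        using x a by (intro mult_mono) (auto simp: padic_ints_def)
      then have ax: "absv (a / x) \<le> 1 / real p"
        by (simp add: absv_divide)
      have xa: "x + a = x * (1 + a / x)"
        using \<open>x \<noteq> 0\<close> by (simp add: field_simps)
      have "x + a \<in> padic_rats"
        using assms(4) a by (intro padic_rats_ops) (auto simp: padic_ints_def)
      then have "padic_bracket p (x + a) = ?B * (1 + a / x)"
        unfolding xa by (rule bracket(2)[OF ax])
      then have "padic_power (padic_bracket p (x + a)) (1 - s)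
        = padic_power ?B (1 - s) * padic_power (1 + a / x) (1 - s)"
        using padic_power_mult[OF bracket(1) _ s, of "1 + a / x"] ax by simp
      moreover have "(\<lambda>i. ((1 - s) gchoose i) * (a / x) ^ i) sums padic_power (1 + a / x) (1 - s)"
        using padic_power_sums[OF _ s, of "1 + a / x"] ax by simp
      then have "(\<lambda>i. padic_power ?B (1 - s) * (((1 - s) gchoose i) * (a / x) ^ i))
        sums (padic_power ?B (1 - s) * padic_power (1 + a / x) (1 - s))"
        by (rule sums_cmult)
      ultimately show ?thesis
        by (simp add: c_def power_divide mult_ac)
    qed
    \<comment> \<open>At \<open>a = 1\<close> the terms of the convergent series are the
      \<open>c i\<close> themselves.\<close>
    have null: "(\<lambda>i. absv (c i)) \<longlonglongrightarrow> 0"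
      using absv_sums_imp_null[OF f[of 1]] of_nat_in_padic_ints[of 1] by simp
    have summable: "summable (\<lambda>i. ((1 - s) gchoose i) * euler_poly i 0 * (1 / x ^ i))"
      using gchoose_series(1)[OF b s] by (simp only: mult.assoc)
    have "(\<lambda>i. c i * euler_poly i 0) sums padic_euler_zeta p s x"
      unfolding padic_euler_zeta_def by (rule fermionic_power_series(2)[OF null f])
    moreover have "(\<lambda>i. c i * euler_poly i 0) sums (padic_power ?B (1 - s)
        * (\<Sum>i. ((1 - s) gchoose i) * euler_poly i 0 * (1 / x ^ i)))"
      using sums_cmult[OF summable_sums[OF summable], of "padic_power ?B (1 - s)"]
      by (simp add: c_def power_one_over mult_ac)
    ultimately show ?thesis
      using summable fermionic_power_series(1)[OF null f] sums_unique2 by blast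
  qed
  \<comment> \<open>Both factors of the closed formula are analytic in s, and products of power
    series converge on the same disc; the zeta function agrees with this product there.\<close>
  have "padic_analytic_on_disc (padic_radius p)
    (\<lambda>s. padic_power ?B (1 - s) * (\<Sum>i. ((1 - s) gchoose i) * (euler_poly i 0 * (1 / x ^ i))))"
    by (intro padic_analytic_on_disc_mult complete padic_power_analytic bracket(1)
        gchoose_series(2)[OF b])
  then have "padic_analytic_on_disc (padic_radius p) (\<lambda>s. padic_euler_zeta p s x)"
    by (rule padic_analytic_on_disc_cong) (simp add: main mult.assoc)
  with main show ?thesis
    by (simp add: padic_euler_zeta_def)
qed

end
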